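(* Let $(M,\Omega,\theta)$ be a closed connected locally conformally symplectic (LCS) manifold. If $$\operatorname{cat}(M,[\theta])>0,$$ then the LCS structure $(\Omega,\theta)$ is of the second kind.
   Context: Closed manifold means compact without boundary. LCS manifolds: let $M$ be a smooth manifold of dimension $2n$, $n\geq 2$. An LCS structure on $M$ is a nondegenerate smooth two-form $\Omega$ for which there exists a closed one-form $\theta$ with $d\Omega=\theta\wedge\Omega$. The form $\theta$ is uniquely determined by $\Omega$ and is called the Lee form; $[\theta]\in H^1(M;\mathbb R)$ is the Lee class. The triple $(M,\Omega,\theta)$ is called an LCS manifold. First and second kind: let $\mathfrak X(M,\Omega)=\{X\in\mathfrak X(M)\mid \mathcal L_X\Omega=0\}$. For $X\in\mathfrak X(M,\Omega)$ the function $\theta(X)$ is constant, so $\ell(X)=\theta(X)$ defines a linear map (Lie algebra homomorphism) $\ell\colon\mathfrak X(M,\Omega)\to\mathbb R$. The LCS structure is of the first kind if $\ell\neq 0$ (equivalently $\ell$ is surjective), and of the second kind if $\ell$ is identically zero. Category of a degree-one class (Farber): let $M$ be a closed connected smooth manifold, $\xi\in H^1(M;\mathbb R)$, and let $\omega$ be a closed one-form representing $\xi$. For a continuous path $\gamma\colon[0,1]\to M$, the integral $\int_\gamma\omega$ is defined by choosing a subdivision $0=t_0<\cdots<t_m=1$ and open sets $U_i\supset\gamma([t_i,t_{i+1}])$ on which $\omega=df_{U_i}$, and setting $\int_\gamma\omega=\sum_{i=0}^{m-1}\bigl(f_{U_i}(\gamma(t_{i+1}))-f_{U_i}(\gamma(t_i))\bigr)$;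 this is independent of choices. For $N>0$, a subset $A\subset M$ is $N$-movable with respect to $\omega$ if there is a homotopy $h_t\colon A\to M$, $t\in[0,1]$, with $h_0$ the inclusion and $\int_{\gamma_x}\omega\leq -N$ for every $x\in A$, where $\gamma_x(t)=h_t(x)$. Then $\operatorname{cat}(M,\xi)$ is the least integer $k\geq 0$ such that for every $N>0$ there is an open cover $M=F\cup F_1\cup\cdots\cup F_k$ where $F$ is $N$-movable with respect to $\omega$ and each inclusion $F_i\hookrightarrow M$ ($i=1,\ldots,k$) is null-homotopic. This number depends only on $\xi$, not on the chosen representative $\omega$. *)

theory Defs
  imports "HOL-Analysis.Analysis"
begin

section \<open>Smooth maps between open subsets of Euclidean spaces\<close>

text \<open>Both notions are meant for open \<open>S\<close> in a finite-dimensional domain, where \<open>f\<close> is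
  \<open>C\<close>-\<open>(k+1)\<close> iff it is differentiable and all its directional derivatives are \<open>C\<close>-\<open>k\<close>.\<close>

primrec cont_diff_on ::
  "nat \<Rightarrow> ('e::euclidean_space \<Rightarrow> 'b::real_normed_vector) \<Rightarrow> 'e set \<Rightarrow> bool" where
  "cont_diff_on 0 f S \<longleftrightarrow> continuous_on S f"
| "cont_diff_on (Suc k) f S \<longleftrightarrow>
     (\<forall>x\<in>S. f differentiable (at x)) \<and>
     (\<forall>v. cont_diff_on k (\<lambda>x. frechet_derivative f (at x) v) S)"

definition smooth_on :: "('e::euclidean_space \<Rightarrow> 'b::real_normed_vector) \<Rightarrow> 'e set \<Rightarrow> bool" where
  "smooth_on f S \<longleftrightarrow> (\<forall>k. cont_diff_on k f S)"


section \<open>Smooth manifolds\<close>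

text \<open>A chart is a pair \<open>(U, \<phi>)\<close>; only the restriction of \<open>\<phi>\<close> to \<open>U\<close> matters. The model space is
  a Euclidean space \<open>'e\<close>, so the dimension of the manifold is \<open>DIM('e)\<close> and there is no boundary.\<close>

type_synonym ('a, 'e) chart = "'a set \<times> ('a \<Rightarrow> 'e)"

abbreviation chart_dom :: "('a, 'e) chart \<Rightarrow> 'a set" where
  "chart_dom c \<equiv> fst c"

abbreviation chart_map :: "('a, 'e) chart \<Rightarrow> 'a \<Rightarrow> 'e" where
  "chart_map c \<equiv> snd c"

definition chart_image :: "('a, 'e) chart \<Rightarrow> 'e set" where
  "chart_image c = chart_map c ` chart_dom c"

definition chart_inv :: "('a, 'e) chart \<Rightarrow> 'e \<Rightarrow> 'a" where
  "chart_inv c = inv_into (chart_dom c) (chart_map c)"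

definition transition :: "('a, 'e) chart \<Rightarrow> ('a, 'e) chart \<Rightarrow> 'e \<Rightarrow> 'e" where
  "transition c d = chart_map d \<circ> chart_inv c"

text \<open>The domain of \<open>transition c d\<close>.\<close>

definition overlap :: "('a, 'e) chart \<Rightarrow> ('a, 'e) chart \<Rightarrow> 'e set" where
  "overlap c d = chart_map c ` (chart_dom c \<inter> chart_dom d)"

definition is_chart :: "'a topology \<Rightarrow> ('a, 'e::euclidean_space) chart \<Rightarrow> bool" where
  "is_chart M c \<longleftrightarrow>
     openin M (chart_dom c) \<and> open (chart_image c) \<and>
     homeomorphic_map (subtopology M (chart_dom c)) (top_of_set (chart_image c)) (chart_map c)"

text \<open>The smooth structure is given by an atlas that need not be maximal.\<close>

definition smooth_manifold :: "'a topology \<Rightarrow> ('a, 'e::euclidean_space) chart set \<Rightarrow> bool" where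
  "smooth_manifold M \<A> \<longleftrightarrow>
     Hausdorff_space M \<and>
     (\<exists>\<B>. countable \<B> \<and> (\<forall>B\<in>\<B>. openin M B) \<and>
          (\<forall>U x. openin M U \<and> x \<in> U \<longrightarrow> (\<exists>B\<in>\<B>. x \<in> B \<and> B \<subseteq> U))) \<and>
     (\<forall>c\<in>\<A>. is_chart M c) \<and>
     topspace M = (\<Union>c\<in>\<A>. chart_dom c) \<and>
     (\<forall>c\<in>\<A>. \<forall>d\<in>\<A>. smooth_on (transition c d) (overlap c d))"

definition closed_manifold :: "'a topology \<Rightarrow> ('a, 'e::euclidean_space) chart set \<Rightarrow> bool" where
  "closed_manifold M \<A> \<longleftrightarrow> smooth_manifold M \<A> \<and> compact_space M"

definition smooth_function :: "('a, 'e::euclidean_space) chart set \<Rightarrow> ('a \<Rightarrow> real) \<Rightarrow> bool" where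
  "smooth_function \<A> f \<longleftrightarrow> (\<forall>c\<in>\<A>. smooth_on (f \<circ> chart_inv c) (chart_image c))"


section \<open>Vector fields and differential forms\<close>

text \<open>Tensor fields are families of coordinate expressions, one for each chart of the atlas, which
  are smooth on the chart images and obey the tensorial transformation law under changes of charts.
  Values outside the chart images, or for charts outside the atlas, are irrelevant.\<close>

type_synonym ('a, 'e) vfield = "('a, 'e) chart \<Rightarrow> 'e \<Rightarrow> 'e"
type_synonym ('a, 'e) form1 = "('a, 'e) chart \<Rightarrow> 'e \<Rightarrow> 'e \<Rightarrow> real"
type_synonym ('a, 'e) form2 = "('a, 'e) chart \<Rightarrow> 'e \<Rightarrow> 'e \<Rightarrow> 'e \<Rightarrow> real"

definition vector_field :: "('a, 'e::euclidean_space) chart set \<Rightarrow> ('a, 'e) vfield \<Rightarrow> bool" where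
  "vector_field \<A> X \<longleftrightarrow>
     (\<forall>c\<in>\<A>. smooth_on (X c) (chart_image c)) \<and>
     (\<forall>c\<in>\<A>. \<forall>d\<in>\<A>. \<forall>u\<in>overlap c d.
        X d (transition c d u) = frechet_derivative (transition c d) (at u) (X c u))"

definition one_form :: "('a, 'e::euclidean_space) chart set \<Rightarrow> ('a, 'e) form1 \<Rightarrow> bool" where
  "one_form \<A> \<theta> \<longleftrightarrow>
     (\<forall>c\<in>\<A>. (\<forall>u\<in>chart_image c. linear (\<theta> c u)) \<and>
             (\<forall>v. smooth_on (\<lambda>u. \<theta> c u v) (chart_image c))) \<and>
     (\<forall>c\<in>\<A>. \<forall>d\<in>\<A>. \<forall>u\<in>overlap c d. \<forall>v.
        \<theta> c u v = \<theta> d (transition c d u) (frechet_derivative (transition c d) (at u) v))"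

definition two_form :: "('a, 'e::euclidean_space) chart set \<Rightarrow> ('a, 'e) form2 \<Rightarrow> bool" where
  "two_form \<A> \<Omega> \<longleftrightarrow>
     (\<forall>c\<in>\<A>. (\<forall>u\<in>chart_image c. bilinear (\<Omega> c u) \<and> (\<forall>v. \<Omega> c u v v = 0)) \<and>
             (\<forall>v w. smooth_on (\<lambda>u. \<Omega> c u v w) (chart_image c))) \<and>
     (\<forall>c\<in>\<A>. \<forall>d\<in>\<A>. \<forall>u\<in>overlap c d. \<forall>v w.
        \<Omega> c u v w = \<Omega> d (transition c d u) (frechet_derivative (transition c d) (at u) v)
                                          (frechet_derivative (transition c d) (at u) w))"

definition nondegenerate :: "('a, 'e::euclidean_space) chart set \<Rightarrow> ('a, 'e) form2 \<Rightarrow> bool" where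
  "nondegenerate \<A> \<Omega> \<longleftrightarrow>
     (\<forall>c\<in>\<A>. \<forall>u\<in>chart_image c. \<forall>v. (\<forall>w. \<Omega> c u v w = 0) \<longrightarrow> v = 0)"

text \<open>The coordinate expressions of \<open>df\<close>, \<open>d\<theta>\<close>, \<open>d\<Omega>\<close>, \<open>\<theta> \<and> \<Omega>\<close> and \<open>L\<^sub>X \<Omega>\<close>. They are the invariant
  formulas evaluated on constant vector fields of the chart: these commute with each other, and
  the Lie bracket of \<open>X\<close> with the constant field \<open>v\<close> is \<open>- D X(v)\<close>.\<close>

definition d0 :: "('a \<Rightarrow> real) \<Rightarrow> ('a, 'e::euclidean_space) form1" where
  "d0 f c u v = frechet_derivative (f \<circ> chart_inv c) (at u) v"

definition d1 :: "('a, 'e::euclidean_space) form1 \<Rightarrow> ('a, 'e) form2" where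
  "d1 \<theta> c u v w =
     frechet_derivative (\<lambda>x. \<theta> c x w) (at u) v - frechet_derivative (\<lambda>x. \<theta> c x v) (at u) w"

definition d2 ::
  "('a, 'e::euclidean_space) form2 \<Rightarrow> ('a, 'e) chart \<Rightarrow> 'e \<Rightarrow> 'e \<Rightarrow> 'e \<Rightarrow> 'e \<Rightarrow> real" where
  "d2 \<Omega> c u v w z =
     frechet_derivative (\<lambda>x. \<Omega> c x w z) (at u) v
     - frechet_derivative (\<lambda>x. \<Omega> c x v z) (at u) w
     + frechet_derivative (\<lambda>x. \<Omega> c x v w) (at u) z"

definition wedge12 ::
  "('a, 'e) form1 \<Rightarrow> ('a, 'e) form2 \<Rightarrow> ('a, 'e) chart \<Rightarrow> 'e \<Rightarrow> 'e \<Rightarrow> 'e \<Rightarrow> 'e \<Rightarrow> real" where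
  "wedge12 \<theta> \<Omega> c u v w z =
     \<theta> c u v * \<Omega> c u w z - \<theta> c u w * \<Omega> c u v z + \<theta> c u z * \<Omega> c u v w"

definition lie_derivative2 ::
  "('a, 'e::euclidean_space) vfield \<Rightarrow> ('a, 'e) form2 \<Rightarrow> ('a, 'e) form2" where
  "lie_derivative2 X \<Omega> c u v w =
     frechet_derivative (\<lambda>x. \<Omega> c x v w) (at u) (X c u)
     + \<Omega> c u (frechet_derivative (X c) (at u) v) w
     + \<Omega> c u v (frechet_derivative (X c) (at u) w)"

definition closed_one_form :: "('a, 'e::euclidean_space) chart set \<Rightarrow> ('a, 'e) form1 \<Rightarrow> bool" where
  "closed_one_form \<A> \<theta> \<longleftrightarrow>
     one_form \<A> \<theta> \<and> (\<forall>c\<in>\<A>. \<forall>u\<in>chart_image c. \<forall>v w. d1 \<theta> c u v w = 0)"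

text \<open>The class of \<open>\<theta>\<close> in \<open>H\<^sup>1(M; R)\<close>, as the set of all closed forms that represent it.\<close>

definition de_Rham_class ::
  "('a, 'e::euclidean_space) chart set \<Rightarrow> ('a, 'e) form1 \<Rightarrow> ('a, 'e) form1 set" where
  "de_Rham_class \<A> \<theta> =
     {\<omega>. closed_one_form \<A> \<omega> \<and>
         (\<exists>f. smooth_function \<A> f \<and>
              (\<forall>c\<in>\<A>. \<forall>u\<in>chart_image c. \<forall>v. \<omega> c u v = \<theta> c u v + d0 f c u v))}"


section \<open>Locally conformally symplectic manifolds\<close>

definition lcs_manifold ::
  "'a topology \<Rightarrow> ('a, 'e::euclidean_space) chart set \<Rightarrow> ('a, 'e) form2 \<Rightarrow> ('a, 'e) form1 \<Rightarrow> bool" where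
  "lcs_manifold M \<A> \<Omega> \<theta> \<longleftrightarrow>
     smooth_manifold M \<A> \<and> (\<exists>n\<ge>2. DIM('e) = 2 * n) \<and>
     two_form \<A> \<Omega> \<and> nondegenerate \<A> \<Omega> \<and> closed_one_form \<A> \<theta> \<and>
     (\<forall>c\<in>\<A>. \<forall>u\<in>chart_image c. \<forall>v w z. d2 \<Omega> c u v w z = wedge12 \<theta> \<Omega> c u v w z)"

definition lcs_vector_fields ::
  "('a, 'e::euclidean_space) chart set \<Rightarrow> ('a, 'e) form2 \<Rightarrow> ('a, 'e) vfield set" where
  "lcs_vector_fields \<A> \<Omega> =
     {X. vector_field \<A> X \<and>
         (\<forall>c\<in>\<A>. \<forall>u\<in>chart_image c. \<forall>v w. lie_derivative2 X \<Omega> c u v w = 0)}"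

text \<open>The constant value of the function \<open>\<theta>(X)\<close>, for \<open>X\<close> in \<open>lcs_vector_fields \<A> \<Omega>\<close>.\<close>

definition lee_hom ::
  "('a, 'e::euclidean_space) chart set \<Rightarrow> ('a, 'e) form1 \<Rightarrow> ('a, 'e) vfield \<Rightarrow> real" where
  "lee_hom \<A> \<theta> X = (THE r. \<forall>c\<in>\<A>. \<forall>u\<in>chart_image c. \<theta> c u (X c u) = r)"

definition lcs_first_kind ::
  "('a, 'e::euclidean_space) chart set \<Rightarrow> ('a, 'e) form2 \<Rightarrow> ('a, 'e) form1 \<Rightarrow> bool" where
  "lcs_first_kind \<A> \<Omega> \<theta> \<longleftrightarrow> (\<exists>X\<in>lcs_vector_fields \<A> \<Omega>. lee_hom \<A> \<theta> X \<noteq> 0)"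

definition lcs_second_kind ::
  "('a, 'e::euclidean_space) chart set \<Rightarrow> ('a, 'e) form2 \<Rightarrow> ('a, 'e) form1 \<Rightarrow> bool" where
  "lcs_second_kind \<A> \<Omega> \<theta> \<longleftrightarrow> (\<forall>X\<in>lcs_vector_fields \<A> \<Omega>. lee_hom \<A> \<theta> X = 0)"


section \<open>Category of a degree-one class\<close>

text \<open>\<open>\<omega> = df\<close> on \<open>U\<close>. Such an \<open>f\<close> is automatically smooth on \<open>U\<close> because \<open>\<omega>\<close> is.\<close>

definition primitive_on ::
  "('a, 'e::euclidean_space) chart set \<Rightarrow> ('a, 'e) form1 \<Rightarrow> 'a set \<Rightarrow> ('a \<Rightarrow> real) \<Rightarrow> bool" where
  "primitive_on \<A> \<omega> U f \<longleftrightarrow>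
     (\<forall>c\<in>\<A>. \<forall>p \<in> U \<inter> chart_dom c.
        ((f \<circ> chart_inv c) has_derivative \<omega> c (chart_map c p)) (at (chart_map c p)))"

definition has_path_integral ::
  "'a topology \<Rightarrow> ('a, 'e::euclidean_space) chart set \<Rightarrow> ('a, 'e) form1 \<Rightarrow>
     (real \<Rightarrow> 'a) \<Rightarrow> real \<Rightarrow> bool" where
  "has_path_integral M \<A> \<omega> \<gamma> I \<longleftrightarrow>
     (\<exists>m (t::nat \<Rightarrow> real) U f.
        t 0 = 0 \<and> t m = 1 \<and> (\<forall>i<m. t i < t (Suc i)) \<and>
        (\<forall>i<m. openin M (U i) \<and> \<gamma> ` {t i..t (Suc i)} \<subseteq> U i \<and> primitive_on \<A> \<omega> (U i) (f i)) \<and>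
        I = (\<Sum>i<m. f i (\<gamma> (t (Suc i))) - f i (\<gamma> (t i))))"

definition path_integral ::
  "'a topology \<Rightarrow> ('a, 'e::euclidean_space) chart set \<Rightarrow> ('a, 'e) form1 \<Rightarrow> (real \<Rightarrow> 'a) \<Rightarrow> real" where
  "path_integral M \<A> \<omega> \<gamma> = (THE I. has_path_integral M \<A> \<omega> \<gamma> I)"

definition movable ::
  "'a topology \<Rightarrow> ('a, 'e::euclidean_space) chart set \<Rightarrow> ('a, 'e) form1 \<Rightarrow> real \<Rightarrow> 'a set \<Rightarrow> bool" where
  "movable M \<A> \<omega> N A \<longleftrightarrow>
     (\<exists>h :: real \<Rightarrow> 'a \<Rightarrow> 'a.
        continuous_map (prod_topology (top_of_set {0..1}) (subtopology M A)) M (\<lambda>(t, x). h t x) \<and>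
        (\<forall>x\<in>A. h 0 x = x) \<and>
        (\<forall>x\<in>A. path_integral M \<A> \<omega> (\<lambda>t. h t x) \<le> - N))"

definition null_homotopic_in :: "'a topology \<Rightarrow> 'a set \<Rightarrow> bool" where
  "null_homotopic_in M F \<longleftrightarrow>
     (\<exists>p. homotopic_with (\<lambda>_. True) (subtopology M F) M (\<lambda>x. x) (\<lambda>_. p))"

definition cat_form :: "'a topology \<Rightarrow> ('a, 'e::euclidean_space) chart set \<Rightarrow> ('a, 'e) form1 \<Rightarrow> nat" where
  "cat_form M \<A> \<omega> =
     (LEAST k. \<forall>N>0. \<exists>F (G :: nat \<Rightarrow> 'a set).
        openin M F \<and> (\<forall>i\<in>{1..k}. openin M (G i)) \<and>
        topspace M = F \<union> (\<Union>i\<in>{1..k}. G i) \<and>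
        movable M \<A> \<omega> N F \<and> (\<forall>i\<in>{1..k}. null_homotopic_in M (G i)))"

text \<open>The value does not depend on the representative of \<open>\<xi>\<close>.\<close>

definition cat_class ::
  "'a topology \<Rightarrow> ('a, 'e::euclidean_space) chart set \<Rightarrow> ('a, 'e) form1 set \<Rightarrow> nat" where
  "cat_class M \<A> \<xi> = cat_form M \<A> (SOME \<omega>. \<omega> \<in> \<xi>)"

end

theory Submission
  imports Defs
begin

text \<open>
  Let \<open>X\<close> be an infinitesimal automorphism and \<open>f = \<theta>(X)\<close>. Differentiating \<open>L\<^sub>X \<Omega> = 0\<close> gives
  \<open>df \<and> \<Omega> = 0\<close>, so nondegeneracy in dimension at least \<open>4\<close> makes \<open>f\<close> constant. If this constant is
  nonzero, then \<open>\<theta>\<close> vanishes nowhere. Instead of integrating \<open>X\<close> to a flow, one pushes points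
  inside finitely many charts in directions on which \<open>\<theta>\<close> is negative. By compactness, the
  composition of these pushes is a deformation of \<open>M\<close> whose paths all have \<open>\<theta>\<close>-integral at most
  \<open>-\<epsilon>\<close>. Iterating it makes the whole of \<open>M\<close> movable by any \<open>N\<close>, also for a cohomologous form, whose
  path integrals differ by a bounded amount. Hence the category is \<open>0\<close>.
\<close>

section \<open>Smooth functions on open sets\<close>

text \<open>The field \<open>X\<close> is used only to see that \<theta> vanishes nowhere;
  afterwards any direction with nonzero value of \<theta> will do, which is why no flow is required.
  What has to be gained is a bound -\<epsilon> that is uniform in the starting point, since each
  further round of pushes starts at the points reached by the previous one.
  \<open>path_integral\<close> is a definite description. The work is therefore done with the
  relation \<open>has_path_integral\<close>: every push runs where a primitive is known, so a value
  is exhibited directly, joining paths adds values, and uniqueness is needed only once, when the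
  estimate is handed to \<open>movable\<close>. \<open>cat_class\<close> evaluates an arbitrarily
  chosen representative of the class, so the vanishing of the category must be shown for every form
  cohomologous to \<theta>, not only for \<theta>.\<close>

lemma frechet_derivative_apply:
  "(f has_derivative f') (at x) \<Longrightarrow> frechet_derivative f (at x) v = f' v"
  using frechet_derivative_at[of f f' x] by simp

text \<open>Openness of \<open>S\<close> lets agreement on \<open>S\<close> pass to the derivatives
  at its points, so that the induction can continue with them.\<close>

lemma cont_diff_on_cong:
  assumes "open S" "\<And>x. x \<in> S \<Longrightarrow> f x = g x" "cont_diff_on k f S"
  shows "cont_diff_on k g S"
  using assms(2,3)
proof (induction k arbitrary: f g)
  case 0
  then show ?case using continuous_on_cong by force
next
  case (Suc k)
  have d: "f differentiable (at x)" if "x \<in> S" for x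
    using Suc.prems(2) that by simp
  have "g differentiable (at x)" if "x \<in> S" for x
    using d[OF that] Suc.prems(1) assms(1) that
    by (meson differentiable_def has_derivative_transform_within_open)
  moreover have "cont_diff_on k (\<lambda>x. frechet_derivative g (at x) v) S" for v
  proof (rule Suc.IH)
    show "cont_diff_on k (\<lambda>x. frechet_derivative f (at x) v) S"
      using Suc.prems(2) by simp
    show "frechet_derivative f (at x) v = frechet_derivative g (at x) v" if "x \<in> S" for x
      using frechet_derivative_transform_within_open[OF d[OF that] assms(1) that Suc.prems(1)]
      by simp
  qed
  ultimately show ?case by simp
qed

lemma cont_diff_on_subset: "cont_diff_on k f T \<Longrightarrow> S \<subseteq> T \<Longrightarrow> cont_diff_on k f S"
  by (induction k arbitrary: f) (auto intro: continuous_on_subset)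

text \<open>The recursion mentions only derivatives of order \<open>k\<close>, so descending one
  order is itself an induction, whose base is that differentiability implies continuity.\<close>

lemma cont_diff_on_Suc_imp: "cont_diff_on (Suc k) f S \<Longrightarrow> cont_diff_on k f S"
proof (induction k arbitrary: f)
  case 0
  then show ?case
    by (auto intro!: continuous_at_imp_continuous_on differentiable_imp_continuous_within)
next
  case (Suc k)
  then show ?case by (metis cont_diff_on.simps(2))
qed

lemma cont_diff_on_const: "cont_diff_on k (\<lambda>_. a) S"
  by (induction k arbitrary: a) auto

lemma cont_diff_on_add:
  assumes "open S" "cont_diff_on k f S" "cont_diff_on k g S"
  shows "cont_diff_on k (\<lambda>x. f x + g x) S"
  using assms(2,3)
proof (induction k arbitrary: f g)
  case 0
  then show ?case by (auto intro: continuous_on_add)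
next
  case (Suc k)
  have d: "f differentiable (at x)" "g differentiable (at x)" if "x \<in> S" for x
    using Suc.prems that by auto
  have "cont_diff_on k (\<lambda>x. frechet_derivative (\<lambda>x. f x + g x) (at x) v) S" for v
  proof (rule cont_diff_on_cong[OF assms(1)])
    show "cont_diff_on k (\<lambda>x. frechet_derivative f (at x) v + frechet_derivative g (at x) v) S"
      using Suc by simp
    show "frechet_derivative f (at x) v + frechet_derivative g (at x) v
        = frechet_derivative (\<lambda>x. f x + g x) (at x) v" if "x \<in> S" for x
      by (rule frechet_derivative_apply[symmetric],
          intro has_derivative_add d[OF that, unfolded frechet_derivative_works])
  qed
  then show ?case using d by simp
qed

lemma cont_diff_on_mult:
  fixes f g :: "'e::euclidean_space \<Rightarrow> real"
  assumes "open S" "cont_diff_on k f S" "cont_diff_on k g S"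
  shows "cont_diff_on k (\<lambda>x. f x * g x) S"
  using assms(2,3)
proof (induction k arbitrary: f g)
  case 0
  then show ?case by (auto intro: continuous_on_mult)
next
  case (Suc k)
  have d: "f differentiable (at x)" "g differentiable (at x)" if "x \<in> S" for x
    using Suc.prems that by auto
  have "cont_diff_on k (\<lambda>x. frechet_derivative (\<lambda>x. f x * g x) (at x) v) S" for v
  proof (rule cont_diff_on_cong[OF assms(1)])
    show "cont_diff_on k (\<lambda>x. f x * frechet_derivative g (at x) v + frechet_derivative f (at x) v * g x) S"
      \<comment> \<open>Each summand pairs a derivative, of class \<open>k\<close>, with an
        undifferentiated factor of class \<open>Suc k\<close>; the latter is weakened to
        \<open>k\<close> before the induction hypothesis applies.\<close>
      using Suc.prems Suc.prems[THEN cont_diff_on_Suc_imp]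
      by (intro cont_diff_on_add assms Suc.IH) simp_all
    show "f x * frechet_derivative g (at x) v + frechet_derivative f (at x) v * g x
        = frechet_derivative (\<lambda>x. f x * g x) (at x) v" if "x \<in> S" for x
      by (rule frechet_derivative_apply[symmetric],
          intro has_derivative_mult d[OF that, unfolded frechet_derivative_works])
  qed
  then show ?case using d by simp
qed

lemma cont_diff_on_bounded_linear:
  assumes "open S" "bounded_linear L" "cont_diff_on k f S"
  shows "cont_diff_on k (\<lambda>x. L (f x)) S"
  using assms(3)
proof (induction k arbitrary: f)
  case 0
  then show ?case by (auto intro: bounded_linear.continuous_on[OF assms(2)])
next
  case (Suc k)
  have d: "f differentiable (at x)" if "x \<in> S" for x
    using Suc.prems that by auto
  have h: "((\<lambda>x. L (f x)) has_derivative (\<lambda>v. L (frechet_derivative f (at x) v))) (at x)"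
    if "x \<in> S" for x
    using bounded_linear.has_derivative[OF assms(2)] d[OF that] frechet_derivative_works by blast
  have "cont_diff_on k (\<lambda>x. frechet_derivative (\<lambda>x. L (f x)) (at x) v) S" for v
  proof (rule cont_diff_on_cong[OF assms(1)])
    show "cont_diff_on k (\<lambda>x. L (frechet_derivative f (at x) v)) S"
      using Suc by simp
    show "L (frechet_derivative f (at x) v) = frechet_derivative (\<lambda>x. L (f x)) (at x) v"
      if "x \<in> S" for x
      using frechet_derivative_apply[OF h[OF that]] by simp
  qed
  moreover have "(\<lambda>x. L (f x)) differentiable (at x)" if "x \<in> S" for x
    using h[OF that] by (auto simp: differentiable_def)
  ultimately show ?case by simp
qed

lemma smooth_on_cong:
  "open S \<Longrightarrow> (\<And>x. x \<in> S \<Longrightarrow> f x = g x) \<Longrightarrow> smooth_on f S \<Longrightarrow> smooth_on g S"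
  unfolding smooth_on_def using cont_diff_on_cong by blast

lemma smooth_on_const: "smooth_on (\<lambda>_. a) S"
  by (simp add: smooth_on_def cont_diff_on_const)

lemma smooth_on_add:
  "open S \<Longrightarrow> smooth_on f S \<Longrightarrow> smooth_on g S \<Longrightarrow> smooth_on (\<lambda>x. f x + g x) S"
  unfolding smooth_on_def using cont_diff_on_add by blast

lemma smooth_on_mult:
  fixes f g :: "'e::euclidean_space \<Rightarrow> real"
  shows "open S \<Longrightarrow> smooth_on f S \<Longrightarrow> smooth_on g S \<Longrightarrow> smooth_on (\<lambda>x. f x * g x) S"
  unfolding smooth_on_def using cont_diff_on_mult by blast

lemma smooth_on_bounded_linear:
  "open S \<Longrightarrow> bounded_linear L \<Longrightarrow> smooth_on f S \<Longrightarrow> smooth_on (\<lambda>x. L (f x)) S"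
  unfolding smooth_on_def using cont_diff_on_bounded_linear by blast

lemma smooth_on_sum:
  assumes "open S" "\<And>i. i \<in> I \<Longrightarrow> smooth_on (f i) S"
  shows "smooth_on (\<lambda>x. \<Sum>i\<in>I. f i x) S"
  using assms(2)
  by (induction I rule: infinite_finite_induct) (auto intro: smooth_on_const smooth_on_add[OF assms(1)])

lemma smooth_on_differentiable: "smooth_on f S \<Longrightarrow> x \<in> S \<Longrightarrow> f differentiable (at x)"
  unfolding smooth_on_def by (metis cont_diff_on.simps(2))

lemma smooth_on_has_derivative:
  "smooth_on f S \<Longrightarrow> x \<in> S \<Longrightarrow> (f has_derivative frechet_derivative f (at x)) (at x)"
  using smooth_on_differentiable frechet_derivative_works by blast

lemma smooth_on_frechet_derivative:
  "smooth_on f S \<Longrightarrow> smooth_on (\<lambda>x. frechet_derivative f (at x) v) S"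
  unfolding smooth_on_def by (metis cont_diff_on.simps(2))

lemma smooth_on_continuous_on: "smooth_on f S \<Longrightarrow> continuous_on S f"
  unfolding smooth_on_def by (metis cont_diff_on.simps(1))

section \<open>Families of linear forms depending on a point\<close>

lemma linear_basis_expansion:
  fixes g :: "'e::euclidean_space \<Rightarrow> real"
  assumes "linear g"
  shows "g y = (\<Sum>b\<in>Basis. (y \<bullet> b) * g b)"
proof -
  have "g y = g (\<Sum>b\<in>Basis. (y \<bullet> b) *\<^sub>R b)" by (simp add: euclidean_representation)
  also have "\<dots> = (\<Sum>b\<in>Basis. (y \<bullet> b) * g b)"
    using assms by (simp add: linear_sum linear_cmul)
  finally show ?thesis .
qed

text \<open>A product rule for the pairing of a form with a vector field. Regularity of
  \<open>A\<close> is known only for each fixed vector, so both factors are expanded in the basis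
  and the scalar product rule is applied to each term; the first summand differentiates
  \<open>A\<close> with the vector frozen at \<open>X u\<close>.\<close>

lemma has_derivative_linear_family:
  fixes A :: "'e::euclidean_space \<Rightarrow> 'e \<Rightarrow> real"
  assumes S: "open S" "u \<in> S" and lin: "\<And>x. x \<in> S \<Longrightarrow> linear (A x)"
    and dA: "\<And>b. (\<lambda>x. A x b) differentiable (at u)" and dX: "X differentiable (at u)"
  shows "((\<lambda>x. A x (X x)) has_derivative
    (\<lambda>v. frechet_derivative (\<lambda>x. A x (X u)) (at u) v + A u (frechet_derivative X (at u) v))) (at u)"
proof -
  let ?dA = "\<lambda>b. frechet_derivative (\<lambda>x. A x b) (at u)" and ?dX = "frechet_derivative X (at u)"
  note hA = dA[unfolded frechet_derivative_works] and hX = dX[unfolded frechet_derivative_works]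
  have "((\<lambda>x. \<Sum>b\<in>Basis. (y \<bullet> b) * A x b) has_derivative (\<lambda>v. \<Sum>b\<in>Basis. (y \<bullet> b) * ?dA b v)) (at u)" for y
    by (intro has_derivative_sum has_derivative_mult_right hA)
  then have "((\<lambda>x. A x y) has_derivative (\<lambda>v. \<Sum>b\<in>Basis. (y \<bullet> b) * ?dA b v)) (at u)" for y
    by (rule has_derivative_transform_within_open[OF _ S]) (simp add: linear_basis_expansion[OF lin, symmetric])
  then have e: "?dA y v = (\<Sum>b\<in>Basis. (y \<bullet> b) * ?dA b v)" for y v
    by (rule frechet_derivative_apply)
  have "((\<lambda>x. \<Sum>b\<in>Basis. (X x \<bullet> b) * A x b) has_derivative
      (\<lambda>v. \<Sum>b\<in>Basis. (X u \<bullet> b) * ?dA b v + (?dX v \<bullet> b) * A u b)) (at u)"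
    by (intro has_derivative_sum has_derivative_mult hA has_derivative_inner_left hX)
  then have "((\<lambda>x. A x (X x)) has_derivative
      (\<lambda>v. \<Sum>b\<in>Basis. (X u \<bullet> b) * ?dA b v + (?dX v \<bullet> b) * A u b)) (at u)"
    by (rule has_derivative_transform_within_open[OF _ S]) (simp add: linear_basis_expansion[OF lin, symmetric])
  moreover have "(\<Sum>b\<in>Basis. (X u \<bullet> b) * ?dA b v + (?dX v \<bullet> b) * A u b) = ?dA (X u) v + A u (?dX v)" for v
    by (simp add: sum.distrib e[of "X u"] linear_basis_expansion[OF lin[OF S(2)], symmetric])
  ultimately show ?thesis by simp
qed

text \<open>Linearity in the argument \<open>b\<close> of the form, with the direction
  \<open>v\<close> fixed. The Poincare lemma needs it, because closedness exchanges these two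
  slots.\<close>

lemma linear_frechet_derivative_family:
  fixes A :: "'e::euclidean_space \<Rightarrow> 'e \<Rightarrow> real"
  assumes S: "open S" "u \<in> S" and lin: "\<And>x. x \<in> S \<Longrightarrow> linear (A x)"
    and dA: "\<And>b. (\<lambda>x. A x b) differentiable (at u)"
  shows "linear (\<lambda>b. frechet_derivative (\<lambda>x. A x b) (at u) v)"
proof (rule linearI)
  note hA = dA[unfolded frechet_derivative_works]
  fix a b :: 'e and r :: real
  have "((\<lambda>x. A x (a + b)) has_derivative
      (\<lambda>v. frechet_derivative (\<lambda>x. A x a) (at u) v + frechet_derivative (\<lambda>x. A x b) (at u) v)) (at u)"
    using has_derivative_add[OF hA hA]
    by (rule has_derivative_transform_within_open[OF _ S]) (simp add: linear_add[OF lin])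
  then show "frechet_derivative (\<lambda>x. A x (a + b)) (at u) v =
      frechet_derivative (\<lambda>x. A x a) (at u) v + frechet_derivative (\<lambda>x. A x b) (at u) v"
    by (rule frechet_derivative_apply)
  have "((\<lambda>x. A x (r *\<^sub>R a)) has_derivative
      (\<lambda>v. r * frechet_derivative (\<lambda>x. A x a) (at u) v)) (at u)"
    using has_derivative_mult_right[OF hA]
    by (rule has_derivative_transform_within_open[OF _ S]) (simp add: linear_cmul[OF lin])
  then show "frechet_derivative (\<lambda>x. A x (r *\<^sub>R a)) (at u) v =
      r *\<^sub>R frechet_derivative (\<lambda>x. A x a) (at u) v"
    by (simp add: frechet_derivative_apply)
qed

lemma smooth_on_linear_family:
  fixes A :: "'e::euclidean_space \<Rightarrow> 'e \<Rightarrow> real"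
  assumes S: "open S" and lin: "\<And>x. x \<in> S \<Longrightarrow> linear (A x)"
    and sA: "\<And>b. smooth_on (\<lambda>x. A x b) S" and sX: "smooth_on X S"
  shows "smooth_on (\<lambda>x. A x (X x)) S"
proof (rule smooth_on_cong[OF S])
  show "smooth_on (\<lambda>x. \<Sum>b\<in>Basis. (X x \<bullet> b) * A x b) S"
    by (intro smooth_on_sum smooth_on_mult S sA smooth_on_bounded_linear[OF S _ sX] bounded_linear_inner_left)
qed (simp add: linear_basis_expansion[OF lin, symmetric])

text \<open>The two iterated directional derivatives both approximate the second difference
  quotient over a small parallelogram.\<close>
lemma second_difference_mvt:
  fixes g :: "'e::euclidean_space \<Rightarrow> real"
  assumes s: "0 < s" and sub: "\<And>a b. 0 \<le> a \<Longrightarrow> a \<le> s \<Longrightarrow> 0 \<le> b \<Longrightarrow> b \<le> s \<Longrightarrow> u + a *\<^sub>R v + b *\<^sub>R w \<in> S"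
    and g: "smooth_on g S"
  shows "\<exists>a b. 0 \<le> a \<and> a \<le> s \<and> 0 \<le> b \<and> b \<le> s \<and>
    g (u + s *\<^sub>R v + s *\<^sub>R w) - g (u + s *\<^sub>R v) - g (u + s *\<^sub>R w) + g u =
    s * s * frechet_derivative (\<lambda>x. frechet_derivative g (at x) v) (at (u + a *\<^sub>R v + b *\<^sub>R w)) w"
proof -
  let ?G = "\<lambda>x. frechet_derivative g (at x) v"
  have lin1: "linear (frechet_derivative g (at x))" if "x \<in> S" for x
    using has_derivative_linear smooth_on_has_derivative[OF g that] by blast
  note sG = smooth_on_frechet_derivative[OF g, of v]
  have lin2: "linear (frechet_derivative ?G (at x))" if "x \<in> S" for x
    using has_derivative_linear smooth_on_has_derivative[OF sG that] by blast
  have d1: "((\<lambda>t. g (u + t *\<^sub>R v + b *\<^sub>R w)) has_derivative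
      (\<lambda>h. h * ?G (u + t *\<^sub>R v + b *\<^sub>R w))) (at t)"
    if "0 \<le> t" "t \<le> s" "0 \<le> b" "b \<le> s" for t b
  proof -
    have "((\<lambda>t. u + t *\<^sub>R v + b *\<^sub>R w) has_derivative (\<lambda>h. h *\<^sub>R v)) (at t)"
      by (auto intro!: derivative_eq_intros)
    from has_derivative_compose[OF this smooth_on_has_derivative[OF g sub]] that
    show ?thesis using lin1[OF sub] that by (simp add: linear_cmul)
  qed
  have d2: "((\<lambda>t. ?G (u + a *\<^sub>R v + t *\<^sub>R w)) has_derivative
      (\<lambda>h. h * frechet_derivative ?G (at (u + a *\<^sub>R v + t *\<^sub>R w)) w)) (at t)"
    if "0 \<le> t" "t \<le> s" "0 \<le> a" "a \<le> s" for t a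
  proof -
    have "((\<lambda>t. u + a *\<^sub>R v + t *\<^sub>R w) has_derivative (\<lambda>h. h *\<^sub>R w)) (at t)"
      by (auto intro!: derivative_eq_intros)
    from has_derivative_compose[OF this smooth_on_has_derivative[OF sG sub]] that
    show ?thesis using lin2[OF sub] that by (simp add: linear_cmul)
  qed
  \<comment> \<open>The second difference is the increment of \<open>p\<close> over
    \<open>[0, s]\<close>. The mean value theorem turns it into an increment of \<open>?G\<close> in
    direction \<open>w\<close>, where it is applied again. The term \<open>0 *\<^sub>R w\<close>
    gives both summands the shape of \<open>d1\<close>.\<close>
  define p where "p = (\<lambda>t. g (u + t *\<^sub>R v + s *\<^sub>R w) - g (u + t *\<^sub>R v + 0 *\<^sub>R w))"
  define p' where "p' = (\<lambda>t h. h * ?G (u + t *\<^sub>R v + s *\<^sub>R w) - h * ?G (u + t *\<^sub>R v + 0 *\<^sub>R w))"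
  have "(p has_derivative p' t) (at t within {0..s})" if "0 \<le> t" "t \<le> s" for t
    unfolding p_def p'_def
    using has_derivative_diff[OF d1[of t s] d1[of t 0]] that s
    by - (rule has_derivative_at_withinI, simp)
  from mvt_simple[where f=p and f'=p', OF s this] obtain a where a: "0 < a" "a < s" and
    ea: "p s - p 0 = p' a (s - 0)" by auto
  define q where "q = (\<lambda>t. ?G (u + a *\<^sub>R v + t *\<^sub>R w))"
  define q' where "q' = (\<lambda>t h. h * frechet_derivative ?G (at (u + a *\<^sub>R v + t *\<^sub>R w)) w)"
  have "(q has_derivative q' t) (at t within {0..s})" if "0 \<le> t" "t \<le> s" for t
    unfolding q_def q'_def using d2[of t a] that a
    by - (rule has_derivative_at_withinI, simp)
  from mvt_simple[where f=q and f'=q', OF s this] obtain b where b: "0 < b" "b < s" and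
    eb: "q s - q 0 = q' b (s - 0)" by auto
  have "p s - p 0 = s * (q s - q 0)"
    unfolding ea by (simp add: p'_def q_def algebra_simps)
  then have "g (u + s *\<^sub>R v + s *\<^sub>R w) - g (u + s *\<^sub>R v) - g (u + s *\<^sub>R w) + g u = s * (s * q' b 1)"
    unfolding eb by (simp add: p_def q'_def)
  then show ?thesis
    using a b by (intro exI[of _ a] exI[of _ b]) (simp add: q'_def)
qed

lemma second_derivative_symmetric:
  fixes g :: "'e::euclidean_space \<Rightarrow> real"
  assumes S: "open S" "u \<in> S" and g: "smooth_on g S"
  shows "frechet_derivative (\<lambda>x. frechet_derivative g (at x) v) (at u) w =
    frechet_derivative (\<lambda>x. frechet_derivative g (at x) w) (at u) v" (is "?P u = ?Q u")
proof -
  define P Q where "P = ?P" and "Q = ?Q"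
  have cont: "isCont P u" "isCont Q u"
    using smooth_on_continuous_on[OF smooth_on_frechet_derivative[OF smooth_on_frechet_derivative[OF g]]] S
    unfolding P_def Q_def by (auto simp: continuous_on_eq_continuous_at)
  have "\<bar>P u - Q u\<bar> < e" if e: "e > 0" for e
  proof -
    obtain d1 where d1: "d1 > 0" "\<And>x. dist x u < d1 \<Longrightarrow> \<bar>P x - P u\<bar> < e / 2"
      using cont(1)[unfolded continuous_at_eps_delta, rule_format, of "e / 2"] e
      by (auto simp: dist_norm)
    obtain d2 where d2: "d2 > 0" "\<And>x. dist x u < d2 \<Longrightarrow> \<bar>Q x - Q u\<bar> < e / 2"
      using cont(2)[unfolded continuous_at_eps_delta, rule_format, of "e / 2"] e
      by (auto simp: dist_norm)
    obtain d3 where d3: "d3 > 0" "ball u d3 \<subseteq> S"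
      using S openE by blast
    define d where "d = min d1 (min d2 d3)"
    have d: "d > 0" using d1 d2 d3 by (simp add: d_def)
    \<comment> \<open>The parallelogram with sides \<open>s *\<^sub>R v\<close> and
      \<open>s *\<^sub>R w\<close> then stays within distance \<open>d\<close> of \<open>u\<close>.
      The \<open>+ 1\<close> keeps the denominator positive and makes the estimate strict.\<close>
    define s where "s = d / (norm v + norm w + 1)"
    have s: "s > 0" unfolding s_def using d by (auto intro!: divide_pos_pos add_nonneg_pos)
    have near: "dist (u + a *\<^sub>R v + b *\<^sub>R w) u < d" if "0 \<le> a" "a \<le> s" "0 \<le> b" "b \<le> s" for a b
    proof -
      have "dist (u + a *\<^sub>R v + b *\<^sub>R w) u = norm (a *\<^sub>R v + b *\<^sub>R w)"
        by (simp add: dist_norm algebra_simps)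
      also have "\<dots> \<le> a * norm v + b * norm w"
        using norm_triangle_ineq[of "a *\<^sub>R v" "b *\<^sub>R w"] that by simp
      also have "\<dots> \<le> s * norm v + s * norm w"
        using that by (intro add_mono mult_right_mono) auto
      also have "\<dots> < s * (norm v + norm w + 1)" using s by (simp add: algebra_simps)
      also have "\<dots> = d" by (simp add: s_def add_nonneg_eq_0_iff)
      finally show ?thesis .
    qed
    have sub1: "u + a *\<^sub>R v + b *\<^sub>R w \<in> S" if "0 \<le> a" "a \<le> s" "0 \<le> b" "b \<le> s" for a b
      using near[OF that] d3 by (auto simp: d_def dist_commute subset_eq)
    have sub2: "u + a *\<^sub>R w + b *\<^sub>R v \<in> S" if "0 \<le> a" "a \<le> s" "0 \<le> b" "b \<le> s" for a b
      using sub1[of b a] that by (simp add: algebra_simps)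
    obtain a b where ab: "0 \<le> a" "a \<le> s" "0 \<le> b" "b \<le> s" and
      e1: "g (u + s *\<^sub>R v + s *\<^sub>R w) - g (u + s *\<^sub>R v) - g (u + s *\<^sub>R w) + g u =
        s * s * P (u + a *\<^sub>R v + b *\<^sub>R w)"
      using second_difference_mvt[OF s sub1 g] unfolding P_def by blast
    obtain a' b' where ab': "0 \<le> a'" "a' \<le> s" "0 \<le> b'" "b' \<le> s" and
      e2: "g (u + s *\<^sub>R w + s *\<^sub>R v) - g (u + s *\<^sub>R w) - g (u + s *\<^sub>R v) + g u =
        s * s * Q (u + a' *\<^sub>R w + b' *\<^sub>R v)"
      using second_difference_mvt[OF s sub2 g] unfolding Q_def by blast
    \<comment> \<open>The second difference is symmetric in \<open>v\<close> and \<open>w\<close>,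
      so the two intermediate values of \<open>P\<close> and \<open>Q\<close> coincide, each being
      close to its value at \<open>u\<close>.\<close>
    have "g (u + s *\<^sub>R w + s *\<^sub>R v) = g (u + s *\<^sub>R v + s *\<^sub>R w)" by (simp add: algebra_simps)
    then have "s * s * P (u + a *\<^sub>R v + b *\<^sub>R w) = s * s * Q (u + a' *\<^sub>R w + b' *\<^sub>R v)"
      using e1 e2 by linarith
    then have eq: "P (u + a *\<^sub>R v + b *\<^sub>R w) = Q (u + b' *\<^sub>R v + a' *\<^sub>R w)"
      using s by (simp add: algebra_simps)
    have "\<bar>P (u + a *\<^sub>R v + b *\<^sub>R w) - P u\<bar> < e / 2"
      using near[OF ab] d1 by (simp add: d_def)
    moreover have "\<bar>Q (u + b' *\<^sub>R v + a' *\<^sub>R w) - Q u\<bar> < e / 2"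
      using near[of b' a'] ab' d2 by (simp add: d_def)
    ultimately show ?thesis using eq by linarith
  qed
  from this[of "\<bar>P u - Q u\<bar>"] have "P u = Q u" by auto
  then show ?thesis by (simp add: P_def Q_def)
qed

section \<open>The exterior derivative of the Lee pairing\<close>

lemma antisymmetric_of_alternating:
  fixes B :: "'e::euclidean_space \<Rightarrow> 'e \<Rightarrow> real"
  assumes "bilinear B" "\<And>v. B v v = 0"
  shows "B v w = - B w v"
proof -
  have "B (v + w) (v + w) = B v v + B v w + B w v + B w w"
    using assms(1) by (simp add: bilinear_ladd bilinear_radd)
  then show ?thesis using assms(2) by simp
qed

text \<open>With \<open>\<beta> = i\<^sub>X \<Omega>\<close> and \<open>f = \<theta>(X)\<close>, Cartan's formula turns \<open>L\<^sub>X \<Omega> = 0\<close> into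
  \<open>d\<beta> = \<theta> \<and> \<beta> - f \<Omega>\<close>; applying \<open>d\<close> once more gives \<open>df \<and> \<Omega> = 0\<close>.\<close>
lemma d_pairing_wedge_eq_0:
  fixes Om :: "'e::euclidean_space \<Rightarrow> 'e \<Rightarrow> 'e \<Rightarrow> real" and th :: "'e \<Rightarrow> 'e \<Rightarrow> real"
    and X :: "'e \<Rightarrow> 'e"
  assumes S: "open S"
    and bil: "\<And>x. x \<in> S \<Longrightarrow> bilinear (Om x)" and alt: "\<And>x v. x \<in> S \<Longrightarrow> Om x v v = 0"
    and sOm: "\<And>v w. smooth_on (\<lambda>x. Om x v w) S"
    and lin: "\<And>x. x \<in> S \<Longrightarrow> linear (th x)" and sth: "\<And>v. smooth_on (\<lambda>x. th x v) S"
    and sX: "smooth_on X S"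
    and closed: "\<And>x v w. x \<in> S \<Longrightarrow>
      frechet_derivative (\<lambda>y. th y w) (at x) v = frechet_derivative (\<lambda>y. th y v) (at x) w"
    and dOm: "\<And>x v w z. x \<in> S \<Longrightarrow>
      frechet_derivative (\<lambda>y. Om y w z) (at x) v - frechet_derivative (\<lambda>y. Om y v z) (at x) w
      + frechet_derivative (\<lambda>y. Om y v w) (at x) z = th x v * Om x w z - th x w * Om x v z + th x z * Om x v w"
    and LX: "\<And>x v w. x \<in> S \<Longrightarrow>
      frechet_derivative (\<lambda>y. Om y v w) (at x) (X x) + Om x (frechet_derivative X (at x) v) w
      + Om x v (frechet_derivative X (at x) w) = 0"
    and u: "u \<in> S"
  defines "Df \<equiv> frechet_derivative (\<lambda>x. th x (X x)) (at u)"
  shows "Df v * Om u w z - Df w * Om u v z + Df z * Om u v w = 0"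
proof -
  define f where "f = (\<lambda>x. th x (X x))"
  \<comment> \<open>\<open>b w\<close> is the component \<beta>(w), and \<open>D w v\<close> is its
    derivative in direction \<open>v\<close>; hence \<open>D w v x - D v w x\<close> is d\<beta>(v,
    w).\<close>
  define b where "b = (\<lambda>w x. Om x (X x) w)"
  define D where "D = (\<lambda>w v x. frechet_derivative (b w) (at x) v)"
  have asym: "Om x v w = - Om x w v" if "x \<in> S" for x v w
    using antisymmetric_of_alternating[OF bil[OF that] alt[OF that]] .
  have linOm: "linear (\<lambda>v. Om x v w)" if "x \<in> S" for x w
    using bil[OF that] by (simp add: bilinear_def)
  have sb: "smooth_on (b w) S" for w
    unfolding b_def
    by (rule smooth_on_linear_family[where A="\<lambda>x v. Om x v w", OF S linOm sOm sX])
  have sf: "smooth_on f S"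
    unfolding f_def by (rule smooth_on_linear_family[OF S lin sth sX])
  have sD: "smooth_on (D w v) S" for w v
    unfolding D_def by (rule smooth_on_frechet_derivative[OF sb])
  have Db: "D w v x = frechet_derivative (\<lambda>y. Om y (X x) w) (at x) v + Om x (frechet_derivative X (at x) v) w"
    if "x \<in> S" for x v w
  proof -
    have "((\<lambda>y. Om y (X y) w) has_derivative (\<lambda>v. frechet_derivative (\<lambda>y. Om y (X x) w) (at x) v
        + Om x (frechet_derivative X (at x) v) w)) (at x)"
      by (rule has_derivative_linear_family[where A="\<lambda>x v. Om x v w", OF S that linOm
            smooth_on_differentiable[OF sOm that] smooth_on_differentiable[OF sX that]])
    then show ?thesis unfolding D_def b_def by (rule frechet_derivative_apply)
  qed
  have dneg: "frechet_derivative (\<lambda>y. Om y v w) (at x) = (\<lambda>z. - frechet_derivative (\<lambda>y. Om y w v) (at x) z)"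
    if "x \<in> S" for x v w
  proof -
    have "((\<lambda>y. Om y v w) has_derivative (\<lambda>z. - frechet_derivative (\<lambda>y. Om y w v) (at x) z)) (at x)"
      using has_derivative_minus[OF smooth_on_has_derivative[OF sOm that, of w v]]
      by (rule has_derivative_transform_within_open[OF _ S that]) (metis asym)
    then show ?thesis by (rule frechet_derivative_at[symmetric])
  qed
  \<comment> \<open>Contracting \<theta> \<and> \<Omega> with \<open>X\<close> gives f \<Omega> -
    \<theta> \<and> \<beta>, and d\<beta> is minus the contraction of d\<Omega>. The hypothesis on
    d\<Omega> concerns constant vectors, so \<open>X x\<close> is inserted as a vector frozen at
    \<open>x\<close>.\<close>
  have dbeta: "D w v x - D v w x = th x v * b w x - th x w * b v x - f x * Om x v w" if "x \<in> S" for x v w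
    using dOm[OF that, of v w "X x"] dOm[OF that, of "X x" v w] LX[OF that, of v w] Db[OF that, of w v] Db[OF that, of v w]
      asym[OF that, of "frechet_derivative X (at x) w" v] fun_cong[OF dneg[OF that, of "X x" v], of w] 
    unfolding f_def b_def by simp
  define DD where "DD = (\<lambda>w v z. frechet_derivative (D w v) (at u) z)"
  have sym: "DD w v z = DD w z v" for w v z
    unfolding DD_def D_def by (rule second_derivative_symmetric[OF S u sb])
  \<comment> \<open>\<open>dbeta\<close> holds on all of the open set \<open>S\<close>, so both of
    its sides may be differentiated at \<open>u\<close>.\<close>
  have ddbeta: "DD w v z - DD v w z =
      (th u v * D w z u + frechet_derivative (\<lambda>x. th x v) (at u) z * b w u)
      - (th u w * D v z u + frechet_derivative (\<lambda>x. th x w) (at u) z * b v u)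
      - (f u * frechet_derivative (\<lambda>x. Om x v w) (at u) z + Df z * Om u v w)" for v w z
  proof -
    have "((\<lambda>x. D w v x - D v w x) has_derivative (\<lambda>z. DD w v z - DD v w z)) (at u)"
      unfolding DD_def by (intro has_derivative_diff smooth_on_has_derivative[OF sD u])
    moreover have "((\<lambda>x. th x v * b w x - th x w * b v x - f x * Om x v w) has_derivative
      (\<lambda>z. (th u v * D w z u + frechet_derivative (\<lambda>x. th x v) (at u) z * b w u)
      - (th u w * D v z u + frechet_derivative (\<lambda>x. th x w) (at u) z * b v u)
      - (f u * frechet_derivative (\<lambda>x. Om x v w) (at u) z + Df z * Om u v w))) (at u)"
      unfolding Df_def D_def f_def[symmetric]
      by (intro has_derivative_diff has_derivative_mult smooth_on_has_derivative[OF _ u] sth sb sOm sf)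
    then have "((\<lambda>x. D w v x - D v w x) has_derivative
      (\<lambda>z. (th u v * D w z u + frechet_derivative (\<lambda>x. th x v) (at u) z * b w u)
      - (th u w * D v z u + frechet_derivative (\<lambda>x. th x w) (at u) z * b v u)
      - (f u * frechet_derivative (\<lambda>x. Om x v w) (at u) z + Df z * Om u v w))) (at u)"
      by (rule has_derivative_transform_within_open[OF _ S u]) (simp add: dbeta)
    ultimately show ?thesis by (rule fun_cong[OF has_derivative_unique])
  qed
  have a1: "Om u z v = - Om u v z" using asym[OF u] .
  have a2: "frechet_derivative (\<lambda>x. Om x z v) (at u) w = - frechet_derivative (\<lambda>x. Om x v z) (at u) w"
    using fun_cong[OF dneg[OF u, of z v]] .
  have dd: "f u * (frechet_derivative (\<lambda>y. Om y w z) (at u) v - frechet_derivative (\<lambda>y. Om y v z) (at u) w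
      + frechet_derivative (\<lambda>y. Om y v w) (at u) z) =
      f u * (th u v * Om u w z - th u w * Om u v z + th u z * Om u v w)"
    by (simp only: dOm[OF u])
  have "D z w u = D w z u + (th u w * b z u - th u z * b w u - f u * Om u w z)"
       "D z v u = D v z u + (th u v * b z u - th u z * b v u - f u * Om u v z)"
       "D w v u = D v w u + (th u v * b w u - th u w * b v u - f u * Om u v w)"
    using dbeta[OF u, of z w] dbeta[OF u, of z v] dbeta[OF u, of w v] by linarith+
  note Deq = this
  \<comment> \<open>The cyclic sum is dd\<beta>(v, w, z), zero by symmetry of second derivatives.
    Its expansion is d\<theta> \<and> \<beta> - \<theta> \<and> d\<beta> - df \<and> \<Omega> - f
    d\<Omega>. The first term vanishes, inserting d\<beta> turns the second into f \<theta> \<and>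
    \<Omega>, and this cancels against the last one.\<close>
  have "0 = (DD w v z - DD v w z) + (DD z w v - DD w z v) + (DD v z w - DD z v w)"
    using sym[of w v z] sym[of v w z] sym[of z v w] by simp
  also have "\<dots> = - (Df v * Om u w z - Df w * Om u v z + Df z * Om u v w)"
    using dd closed[OF u, of v w] closed[OF u, of w z] closed[OF u, of v z]
    unfolding ddbeta a1 a2 Deq by (simp add: algebra_simps)
  finally show ?thesis by simp
qed

text \<open>If \<open>a v\<close> were nonzero, the two linear equations \<open>a w = 0\<close> and
  \<open>B v w = 0\<close> would still have a solution \<open>w \<noteq> 0\<close>, because the
  dimension exceeds 2. The wedge identity at \<open>v\<close>, \<open>w\<close>, \<open>z\<close>
  then reads \<open>a v * B w z = 0\<close> for all \<open>z\<close>, against nondegeneracy. In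
  dimension 2 the identity is void, as every 3-form vanishes.\<close>

lemma eq_0_of_wedge_nondegenerate:
  fixes B :: "'e::euclidean_space \<Rightarrow> 'e \<Rightarrow> real"
  assumes dim: "DIM('e) > 2" and bil: "bilinear B" and alt: "\<And>v. B v v = 0"
    and nondeg: "\<And>v. (\<And>w. B v w = 0) \<Longrightarrow> v = 0" and lin: "linear a"
    and wedge: "\<And>v w z. a v * B w z - a w * B v z + a z * B v w = 0"
  shows "a v = 0"
proof (rule ccontr)
  assume v: "a v \<noteq> 0"
  define L where "L = (\<lambda>w. (a w, B v w))"
  have "linear (B v)" using bil by (simp add: bilinear_def)
  then have L: "linear L"
    unfolding L_def using lin by (auto simp: linear_iff)
  have "\<not> inj L"
  proof
    assume "inj L"
    then have "dim (range L) = dim (UNIV :: 'e set)"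
      using L by (metis dim_image_eq subset_UNIV inj_on_subset)
    moreover have "dim (range L) \<le> DIM(real \<times> real)" by (rule dim_subset_UNIV)
    ultimately show False using dim by simp
  qed
  then obtain w where w: "L w = 0" "w \<noteq> 0"
    using L by (metis linear_injective_0)
  then have aw: "a w = 0" "B v w = 0" by (auto simp: L_def zero_prod_def)
  have "B w z = 0" for z
    using wedge[of v w z] aw v by simp
  then show False using nondeg w by blast
qed

section \<open>Charts and path integrals\<close>

lemma connected_space_locally_constant:
  assumes "connected_space X"
    and loc: "\<And>p. p \<in> topspace X \<Longrightarrow> \<exists>V. openin X V \<and> p \<in> V \<and> (\<forall>q\<in>V. F q = F p)"
    and pq: "p \<in> topspace X" "q \<in> topspace X"
  shows "F p = F q"
proof -
  define T where "T = {x \<in> topspace X. F x = F p}"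
  have "openin X T"
  proof (subst openin_subopen, intro ballI)
    fix x assume "x \<in> T"
    then have x: "x \<in> topspace X" "F x = F p" by (auto simp: T_def)
    from loc[OF x(1)] obtain V where V: "openin X V" "x \<in> V" "\<forall>q\<in>V. F q = F x" by blast
    have "F q = F p" if "q \<in> V" for q by (rule trans[OF bspec[OF V(3) that] x(2)])
    then have "V \<subseteq> T" using openin_subset[OF V(1)] by (auto simp: T_def)
    then show "\<exists>W. openin X W \<and> x \<in> W \<and> W \<subseteq> T" using V by blast
  qed
  moreover have "openin X (topspace X - T)"
  proof (subst openin_subopen, intro ballI)
    fix x assume "x \<in> topspace X - T"
    then have x: "x \<in> topspace X" "F x \<noteq> F p" by (auto simp: T_def)
    from loc[OF x(1)] obtain V where V: "openin X V" "x \<in> V" "\<forall>q\<in>V. F q = F x" by blast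
    have "F q \<noteq> F p" if "q \<in> V" for q using bspec[OF V(3) that] x(2) by metis
    then have "V \<subseteq> topspace X - T" using openin_subset[OF V(1)] by (auto simp: T_def)
    then show "\<exists>W. openin X W \<and> x \<in> W \<and> W \<subseteq> topspace X - T" using V by blast
  qed
  ultimately have "T = {} \<or> T = topspace X"
    using assms(1) unfolding connected_space_clopen_in closedin_def by (auto simp: T_def)
  then have "q \<in> T" using pq by (auto simp: T_def)
  then show ?thesis by (simp add: T_def)
qed

locale manifold =
  fixes M :: "'a topology" and \<A> :: "('a, 'e::euclidean_space) chart set"
  assumes smooth_manifold: "smooth_manifold M \<A>"
begin

lemma is_chart: "c \<in> \<A> \<Longrightarrow> is_chart M c"
  using smooth_manifold by (simp add: smooth_manifold_def)

lemma openin_chart_dom: "c \<in> \<A> \<Longrightarrow> openin M (chart_dom c)"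
  using is_chart by (auto simp: is_chart_def)

lemma open_chart_image: "c \<in> \<A> \<Longrightarrow> open (chart_image c)"
  using is_chart by (auto simp: is_chart_def)

lemma homeomorphic_map_chart:
  "c \<in> \<A> \<Longrightarrow> homeomorphic_map (subtopology M (chart_dom c)) (top_of_set (chart_image c)) (chart_map c)"
  using is_chart by (auto simp: is_chart_def)

lemma chart_dom_subset: "c \<in> \<A> \<Longrightarrow> chart_dom c \<subseteq> topspace M"
  using openin_chart_dom openin_subset by blast

lemma chart_exists:
  assumes "p \<in> topspace M" obtains c where "c \<in> \<A>" "p \<in> chart_dom c"
  using assms smooth_manifold by (auto simp: smooth_manifold_def)

lemma inj_on_chart: "c \<in> \<A> \<Longrightarrow> inj_on (chart_map c) (chart_dom c)"
  using homeomorphic_imp_injective_map[OF homeomorphic_map_chart] chart_dom_subset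
  by (simp add: inf.absorb2)

lemma chart_inv_chart_map [simp]: "c \<in> \<A> \<Longrightarrow> x \<in> chart_dom c \<Longrightarrow> chart_inv c (chart_map c x) = x"
  unfolding chart_inv_def by (rule inv_into_f_f[OF inj_on_chart])

lemma chart_map_in_image [intro]: "x \<in> chart_dom c \<Longrightarrow> chart_map c x \<in> chart_image c"
  by (simp add: chart_image_def)

lemma chart_map_chart_inv [simp]: "u \<in> chart_image c \<Longrightarrow> chart_map c (chart_inv c u) = u"
  unfolding chart_inv_def chart_image_def by (rule f_inv_into_f)

lemma chart_inv_in_dom [intro]: "u \<in> chart_image c \<Longrightarrow> chart_inv c u \<in> chart_dom c"
  unfolding chart_inv_def chart_image_def by (rule inv_into_into)

lemma continuous_map_chart:
  "c \<in> \<A> \<Longrightarrow> continuous_map (subtopology M (chart_dom c)) euclidean (chart_map c)"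
  using homeomorphic_imp_continuous_map[OF homeomorphic_map_chart] continuous_map_into_fulltopology
  by blast

lemma continuous_map_chart_inv:
  assumes c: "c \<in> \<A>" shows "continuous_map (top_of_set (chart_image c)) M (chart_inv c)"
proof -
  obtain g where g: "homeomorphic_maps (subtopology M (chart_dom c)) (top_of_set (chart_image c)) (chart_map c) g"
    using homeomorphic_map_chart[OF c] homeomorphic_map_maps by blast
  then have "continuous_map (top_of_set (chart_image c)) M g"
    using continuous_map_into_fulltopology by (auto simp: homeomorphic_maps_def)
  moreover have "g u = chart_inv c u" if "u \<in> chart_image c" for u
  proof -
    have "chart_inv c u \<in> topspace (subtopology M (chart_dom c))"
      using chart_inv_in_dom[OF that] chart_dom_subset[OF c] by auto
    then have "g (chart_map c (chart_inv c u)) = chart_inv c u"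
      using g unfolding homeomorphic_maps_def by blast
    then show ?thesis using that by simp
  qed
  ultimately show ?thesis by (auto intro: continuous_map_eq)
qed

lemma openin_chart_preimage:
  assumes c: "c \<in> \<A>" and "open W" shows "openin M {x \<in> chart_dom c. chart_map c x \<in> W}"
proof -
  have "openin (subtopology M (chart_dom c)) {x \<in> topspace (subtopology M (chart_dom c)). chart_map c x \<in> W}"
    using openin_continuous_map_preimage[OF continuous_map_chart[OF c]] assms(2) by auto
  moreover have "{x \<in> topspace (subtopology M (chart_dom c)). chart_map c x \<in> W} = {x \<in> chart_dom c. chart_map c x \<in> W}"
    using chart_dom_subset[OF c] by auto
  ultimately show ?thesis using openin_trans_full openin_chart_dom[OF c] by metis
qed

lemma open_chart_map_image:
  assumes c: "c \<in> \<A>" and U: "openin M U" shows "open (chart_map c ` (U \<inter> chart_dom c))"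
proof -
  have "openin (subtopology M (chart_dom c)) (U \<inter> chart_dom c)"
    using U by (rule openin_subtopology_Int)
  then have "openin (top_of_set (chart_image c)) (chart_map c ` (U \<inter> chart_dom c))"
    using homeomorphic_map_openness_eq[OF homeomorphic_map_chart[OF c]] by blast
  then show ?thesis using open_chart_image[OF c] openin_open_trans by blast
qed

lemma has_derivative_transition:
  assumes "c \<in> \<A>" "d \<in> \<A>" "u \<in> overlap c d"
  shows "(transition c d has_derivative frechet_derivative (transition c d) (at u)) (at u)"
proof -
  have "smooth_on (transition c d) (overlap c d)"
    using smooth_manifold assms(1,2) unfolding smooth_manifold_def by blast
  then show ?thesis using assms(3) by (rule smooth_on_has_derivative)
qed

lemma chart_map_in_overlap: "x \<in> chart_dom c \<Longrightarrow> x \<in> chart_dom d \<Longrightarrow> chart_map c x \<in> overlap c d"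
  by (auto simp: overlap_def)

lemma transition_chart_map: "c \<in> \<A> \<Longrightarrow> x \<in> chart_dom c \<Longrightarrow> transition c d (chart_map c x) = chart_map d x"
  by (simp add: transition_def)

lemma chart_preimage_ball:
  assumes c: "c \<in> \<A>" and U: "openin M U" and p: "p \<in> U \<inter> chart_dom c"
  obtains r where "r > 0" "ball (chart_map c p) r \<subseteq> chart_image c"
    "{x \<in> chart_dom c. chart_map c x \<in> ball (chart_map c p) r} \<subseteq> U"
proof -
  obtain r where r: "r > 0" "ball (chart_map c p) r \<subseteq> chart_map c ` (U \<inter> chart_dom c)"
    using open_chart_map_image[OF c U] p openE by (metis imageI)
  moreover have "ball (chart_map c p) r \<subseteq> chart_image c"
    using r(2) by (auto simp: chart_image_def)
  moreover have "x \<in> U" if "x \<in> chart_dom c" "chart_map c x \<in> ball (chart_map c p) r" for x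
  proof -
    obtain y where "y \<in> U \<inter> chart_dom c" "chart_map c x = chart_map c y"
      using r(2) \<open>chart_map c x \<in> _\<close> by blast
    then show ?thesis using inj_on_chart[OF c] that(1) by (auto dest: inj_onD)
  qed
  ultimately show ?thesis using that by blast
qed

text \<open>A ball in the chart is convex, so a vanishing derivative gives constancy there. This
  serves both for differences of primitives and for the pairing of \<theta> with
  \<open>X\<close>.\<close>

lemma locally_constant_of_chart_derivative:
  assumes c: "c \<in> \<A>" and U: "openin M U" and p: "p \<in> U \<inter> chart_dom c"
    and der: "\<And>q. q \<in> U \<inter> chart_dom c \<Longrightarrow> ((F \<circ> chart_inv c) has_derivative (\<lambda>_. 0)) (at (chart_map c q))"
  shows "\<exists>V. openin M V \<and> p \<in> V \<and> V \<subseteq> U \<and> (\<forall>q\<in>V. F q = F p)"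
proof -
  obtain r where r: "r > 0" "ball (chart_map c p) r \<subseteq> chart_image c"
    "{x \<in> chart_dom c. chart_map c x \<in> ball (chart_map c p) r} \<subseteq> U"
    using chart_preimage_ball[OF c U p] by blast
  let ?V = "{x \<in> chart_dom c. chart_map c x \<in> ball (chart_map c p) r}"
  have z: "((F \<circ> chart_inv c) has_derivative (\<lambda>_. 0)) (at u within ball (chart_map c p) r)"
    if "u \<in> ball (chart_map c p) r" for u
  proof -
    have "u \<in> chart_image c" using that r by blast
    then have "chart_inv c u \<in> U \<inter> chart_dom c" using r that by auto
    from der[OF this] \<open>u \<in> chart_image c\<close> show ?thesis
      by (simp add: has_derivative_at_withinI)
  qed
  have "F q = F p" if "q \<in> ?V" for q
    using has_derivative_zero_unique[OF convex_ball z, of "chart_map c q" "chart_map c p"] that r(1) p c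
    by simp
  moreover have "openin M ?V" by (rule openin_chart_preimage[OF c open_ball])
  moreover have "p \<in> ?V" using p r(1) by simp
  ultimately show ?thesis using r(3) by blast
qed

text \<open>The conclusion is only local: \<open>U \<inter> V\<close> may be disconnected, and then
  the difference of the primitives can take several values on it.\<close>

lemma primitive_on_unique:
  assumes "openin M U" "openin M V" "p \<in> U" "p \<in> V"
    and f: "primitive_on \<A> \<omega> U f" and g: "primitive_on \<A> \<omega> V g"
  shows "\<exists>W. openin M W \<and> p \<in> W \<and> (\<forall>q\<in>W. f q - g q = f p - g p)"
proof -
  have "p \<in> topspace M" using assms openin_subset by blast
  then obtain c where c: "c \<in> \<A>" "p \<in> chart_dom c" using chart_exists by blast
  have der: "(((\<lambda>x. f x - g x) \<circ> chart_inv c) has_derivative (\<lambda>_. 0)) (at (chart_map c q))"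
    if "q \<in> (U \<inter> V) \<inter> chart_dom c" for q
  proof -
    have "((f \<circ> chart_inv c) has_derivative \<omega> c (chart_map c q)) (at (chart_map c q))"
      "((g \<circ> chart_inv c) has_derivative \<omega> c (chart_map c q)) (at (chart_map c q))"
      using f g c that unfolding primitive_on_def by auto
    from has_derivative_diff[OF this] show ?thesis by (simp add: o_def)
  qed
  have "openin M (U \<inter> V)" "p \<in> (U \<inter> V) \<inter> chart_dom c" using assms c by auto
  from locally_constant_of_chart_derivative[where F="\<lambda>x. f x - g x", OF c(1) this der]
  show ?thesis by blast
qed

text \<open>\<open>primitive_on\<close> refers to all charts of the atlas. The chain rule for the
  transition map, together with the transformation law of \<omega>, carries a primitive from the
  single chart \<open>c\<close> to the others.\<close>

lemma primitive_on_chart: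
  assumes \<omega>: "one_form \<A> \<omega>" and c: "c \<in> \<A>" and W: "W \<subseteq> chart_image c"
    and g: "\<And>u. u \<in> W \<Longrightarrow> (g has_derivative \<omega> c u) (at u)"
  shows "primitive_on \<A> \<omega> {x \<in> chart_dom c. chart_map c x \<in> W} (g \<circ> chart_map c)"
  unfolding primitive_on_def
proof (intro ballI)
  fix d p assume d: "d \<in> \<A>" and p: "p \<in> {x \<in> chart_dom c. chart_map c x \<in> W} \<inter> chart_dom d"
  let ?v = "chart_map d p"
  have ov: "?v \<in> overlap d c" using p by (intro chart_map_in_overlap) auto
  have tr: "transition d c ?v = chart_map c p" using p by (intro transition_chart_map[OF d]) auto
  have "(g has_derivative \<omega> c (transition d c ?v)) (at (transition d c ?v))"
    using g p tr by simp
  from has_derivative_compose[OF has_derivative_transition[OF d c ov] this]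
  have "((\<lambda>u. g (transition d c u)) has_derivative
      (\<lambda>w. \<omega> c (transition d c ?v) (frechet_derivative (transition d c) (at ?v) w))) (at ?v)" .
  moreover have "(\<lambda>w. \<omega> c (transition d c ?v) (frechet_derivative (transition d c) (at ?v) w)) = \<omega> d ?v"
    using \<omega> d c ov unfolding one_form_def by (intro ext) metis
  ultimately show "((g \<circ> chart_map c \<circ> chart_inv d) has_derivative \<omega> d (chart_map d p)) (at (chart_map d p))"
    by (simp add: transition_def o_def)
qed

end

section \<open>Path integrals: uniqueness and additivity\<close>

text \<open>With \<open>s\<close> clamped to each subinterval, those that end before
  \<open>s\<close> contribute their full increment and those that begin after \<open>s\<close>
  contribute nothing. An integral up to time \<open>s\<close> thus becomes a sum over an index range
  independent of \<open>s\<close>.\<close>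

lemma sum_clamp_telescope:
  fixes t :: "nat \<Rightarrow> real" and h :: "real \<Rightarrow> real"
  assumes "\<And>i. i < m \<Longrightarrow> t i < t (Suc i)"
  shows "t 0 \<le> t m \<and>
    (\<Sum>i<m. h (max (t i) (min s (t (Suc i)))) - h (t i)) = h (max (t 0) (min s (t m))) - h (t 0)"
  using assms
proof (induction m)
  case (Suc m)
  have "t 0 \<le> t m" "t m < t (Suc m)"
    "(\<Sum>i<m. h (max (t i) (min s (t (Suc i)))) - h (t i)) = h (max (t 0) (min s (t m))) - h (t 0)"
    using Suc by auto
  then show ?case by (cases "s \<le> t m") (auto simp: max_def min_def)
qed auto

text \<open>\<open>F\<close> is the integral of \<open>\<omega>\<close> along \<open>\<gamma>\<close> up to time \<open>s\<close>.\<close>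
lemma (in manifold) path_integral_function:
  assumes \<gamma>: "continuous_map (top_of_set {0..1}) M \<gamma>" and I: "has_path_integral M \<A> \<omega> \<gamma> I"
  obtains F where "F 0 = (0::real)" "F 1 = I"
    "\<And>s V g. s \<in> {0..1} \<Longrightarrow> openin M V \<Longrightarrow> \<gamma> s \<in> V \<Longrightarrow> primitive_on \<A> \<omega> V g \<Longrightarrow>
      \<forall>\<^sub>F s' in at s within {0..1}. F s' - g (\<gamma> s') = F s - g (\<gamma> s)"
    "\<And>s. s \<in> {0..1} \<Longrightarrow> \<exists>V g. openin M V \<and> \<gamma> s \<in> V \<and> primitive_on \<A> \<omega> V g"
proof -
  obtain m and t :: "nat \<Rightarrow> real" and U f where t: "t 0 = 0" "t m = 1" "\<And>i. i < m \<Longrightarrow> t i < t (Suc i)"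
    and U: "\<And>i. i < m \<Longrightarrow> openin M (U i)" "\<And>i. i < m \<Longrightarrow> \<gamma> ` {t i..t (Suc i)} \<subseteq> U i"
      "\<And>i. i < m \<Longrightarrow> primitive_on \<A> \<omega> (U i) (f i)"
    and Ieq: "I = (\<Sum>i<m. f i (\<gamma> (t (Suc i))) - f i (\<gamma> (t i)))"
    using I unfolding has_path_integral_def by blast
  define cl where "cl = (\<lambda>i s. max (t i) (min s (t (Suc i))))"
  define F where "F = (\<lambda>s. \<Sum>i<m. f i (\<gamma> (cl i s)) - f i (\<gamma> (t i)))"
  have mono: "t i \<le> t j" if "i \<le> j" "j \<le> m" for i j
    using that(1,2)
  proof (induction j rule: dec_induct)
    case (step j) then show ?case using t(3)[of j] by auto
  qed auto
  have bounds: "0 \<le> t i" "t (Suc i) \<le> 1" if "i < m" for i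
    using mono[of 0 i] mono[of "Suc i" m] that t by auto
  have cl0: "cl i 0 = t i" and cl1: "cl i 1 = t (Suc i)" if "i < m" for i
    using bounds[OF that] t(3)[OF that] by (auto simp: cl_def)
  show ?thesis
  proof (rule that[of F])
    show "F 0 = 0" using cl0 by (simp add: F_def)
    show "F 1 = I" using cl1 by (simp add: F_def Ieq)
    fix s :: real assume s: "s \<in> {0..1}"
    {
      have "\<exists>i<m. t i \<le> s \<and> s \<le> t (Suc i)"
      proof (rule ccontr)
        assume *: "\<not> ?thesis"
        have "t i \<le> s" if "i \<le> m" for i
          using that
        proof (induction i)
          case 0 then show ?case using s t by simp
        next
          case (Suc i) then show ?case using * by (metis Suc_leD Suc_le_lessD linear)
        qed
        then have "s = 1" using t(2) s by force
        moreover have "m > 0" using t by (metis gr0I zero_neq_one)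
        ultimately show False
          using * \<open>\<And>i. i \<le> m \<Longrightarrow> t i \<le> s\<close> t(2) by (metis Suc_pred diff_le_self le_refl lessI)
      qed
      then show "\<exists>V g. openin M V \<and> \<gamma> s \<in> V \<and> primitive_on \<A> \<omega> V g"
        using U by (metis atLeastAtMost_iff image_subset_iff)
    next
      fix V g assume V: "openin M V" "\<gamma> s \<in> V" "primitive_on \<A> \<omega> V g"
      \<comment> \<open>If \<open>s\<close> lies outside the i-th subinterval, the clamp is constant
        near \<open>s\<close> and both sides vanish. Otherwise the clamped times tend to
        \<open>s\<close>, and near \<open>\<gamma> s\<close> the primitives \<open>f i\<close> and
        \<open>g\<close> differ by a constant.\<close>
      have ev: "\<forall>\<^sub>F s' in at s within {0..1}. f i (\<gamma> (cl i s')) - f i (\<gamma> (cl i s)) = g (\<gamma> (cl i s')) - g (\<gamma> (cl i s))"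
        if i: "i < m" for i
      proof -
        have lim: "((cl i) \<longlongrightarrow> cl i s) (at s within {0..1})"
          unfolding cl_def by (intro tendsto_intros)
        consider "s < t i" | "s > t (Suc i)" | "t i \<le> s" "s \<le> t (Suc i)" by linarith
        then show ?thesis
        proof cases
          case 1
          then have "\<forall>\<^sub>F s' in at s within {0..1}. s' < t i"
            by (intro order_tendstoD(2)[OF tendsto_ident_at])
          then show ?thesis
            by eventually_elim (use 1 in \<open>simp add: cl_def\<close>)
        next
          case 2
          then have "\<forall>\<^sub>F s' in at s within {0..1}. s' > t (Suc i)"
            by (intro order_tendstoD(1)[OF tendsto_ident_at])
          then show ?thesis
            by eventually_elim (use 2 in \<open>simp add: cl_def\<close>)
        next
          case 3
          then have cls: "cl i s = s" by (simp add: cl_def)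
          have "\<gamma> s \<in> U i" using U(2)[OF i] 3 by auto
          from primitive_on_unique[OF U(1)[OF i] V(1) this V(2) U(3)[OF i] V(3)]
          obtain W where W: "openin M W" "\<gamma> s \<in> W" "\<forall>q\<in>W. f i q - g q = f i (\<gamma> s) - g (\<gamma> s)" by blast
          have "openin (top_of_set {0..1}) {x \<in> {0..1}. \<gamma> x \<in> W}"
            using openin_continuous_map_preimage[OF \<gamma> W(1)] by simp
          then obtain T where T: "open T" "{x \<in> {0..1}. \<gamma> x \<in> W} = {0..1} \<inter> T"
            unfolding openin_open by blast
          have "s \<in> T" using T s W by blast
          then have "\<forall>\<^sub>F s' in at s within {0..1}. cl i s' \<in> T"
            using topological_tendstoD[OF lim T(1)] cls by simp
          then show ?thesis
          proof eventually_elim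
            case (elim s')
            have "cl i s' \<in> {0..1}" using bounds[OF i] t(3)[OF i] by (auto simp: cl_def)
            then have "\<gamma> (cl i s') \<in> W" using elim T by blast
            then show ?case using W(3) cls by fastforce
          qed
        qed
      qed
      \<comment> \<open>Once every \<open>f i\<close> is traded for the single function
        \<open>g\<close>, the increments telescope; \<open>g\<close> is used here merely as a
        function, also far from \<open>V\<close>.\<close>
      have tel: "(\<Sum>i<m. g (\<gamma> (cl i s')) - g (\<gamma> (t i))) = g (\<gamma> s') - g (\<gamma> 0)" if "s' \<in> {0..1}" for s'
        using sum_clamp_telescope[where m=m and t=t and h="g \<circ> \<gamma>" and s=s', OF t(3)] t(1,2) that unfolding cl_def by simp
      have "\<forall>\<^sub>F s' in at s within {0..1}. \<forall>i\<in>{..<m}. f i (\<gamma> (cl i s')) - f i (\<gamma> (cl i s)) = g (\<gamma> (cl i s')) - g (\<gamma> (cl i s))"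
        by (rule eventually_ball_finite) (auto intro: ev)
      moreover have "\<forall>\<^sub>F s' in at s within {0..1}. s' \<in> {0..1}"
        by (auto simp: eventually_at_filter)
      ultimately show "\<forall>\<^sub>F s' in at s within {0..1}. F s' - g (\<gamma> s') = F s - g (\<gamma> s)"
      proof eventually_elim
        case (elim s')
        have "F s' - F s = (\<Sum>i<m. f i (\<gamma> (cl i s')) - f i (\<gamma> (cl i s)))"
          unfolding F_def sum_subtractf[symmetric] by (rule sum.cong) auto
        also have "\<dots> = (\<Sum>i<m. g (\<gamma> (cl i s')) - g (\<gamma> (cl i s)))"
          using elim by (intro sum.cong) auto
        also have "\<dots> = (\<Sum>i<m. g (\<gamma> (cl i s')) - g (\<gamma> (t i))) - (\<Sum>i<m. g (\<gamma> (cl i s)) - g (\<gamma> (t i)))"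
          unfolding sum_subtractf[symmetric] by (rule sum.cong) auto
        also have "\<dots> = g (\<gamma> s') - g (\<gamma> s)" using tel s elim by simp
        finally show ?case by simp
      qed
    }
  qed
qed

context manifold
begin

text \<open>No common refinement of the subdivisions is formed. Both partial integrals follow every
  local primitive of \<omega> along \<gamma>, so their difference is locally constant on the
  connected interval and starts at 0.\<close>

lemma has_path_integral_unique:
  assumes \<gamma>: "continuous_map (top_of_set {0..1}) M \<gamma>"
    and "has_path_integral M \<A> \<omega> \<gamma> I" "has_path_integral M \<A> \<omega> \<gamma> J"
  shows "I = J"
proof -
  obtain F where F: "F 0 = (0::real)" "F 1 = I"
    "\<And>s V g. s \<in> {0..1} \<Longrightarrow> openin M V \<Longrightarrow> \<gamma> s \<in> V \<Longrightarrow> primitive_on \<A> \<omega> V g \<Longrightarrow>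
      \<forall>\<^sub>F s' in at s within {0..1}. F s' - g (\<gamma> s') = F s - g (\<gamma> s)"
    "\<And>s. s \<in> {0..1} \<Longrightarrow> \<exists>V g. openin M V \<and> \<gamma> s \<in> V \<and> primitive_on \<A> \<omega> V g"
    using path_integral_function[OF \<gamma> assms(2)] by blast
  obtain G where G: "G 0 = (0::real)" "G 1 = J"
    "\<And>s V g. s \<in> {0..1} \<Longrightarrow> openin M V \<Longrightarrow> \<gamma> s \<in> V \<Longrightarrow> primitive_on \<A> \<omega> V g \<Longrightarrow>
      \<forall>\<^sub>F s' in at s within {0..1}. G s' - g (\<gamma> s') = G s - g (\<gamma> s)"
    using path_integral_function[OF \<gamma> assms(3)] by blast
  have "F 0 - G 0 = F 1 - G 1"
  proof (rule connected_local_const[where A="{0..1::real}" and f="\<lambda>s. F s - G s"])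
    show "\<forall>a\<in>{0..1}. \<forall>\<^sub>F b in at a within {0..1}. F a - G a = F b - G b"
    proof
      fix a :: real assume a: "a \<in> {0..1}"
      obtain V g where V: "openin M V" "\<gamma> a \<in> V" "primitive_on \<A> \<omega> V g" using F(4)[OF a] by blast
      from F(3)[OF a V] G(3)[OF a V] show "\<forall>\<^sub>F b in at a within {0..1}. F a - G a = F b - G b"
        by eventually_elim simp
    qed
  qed auto
  then show ?thesis using F G by simp
qed

lemma path_integral_eq:
  "continuous_map (top_of_set {0..1}) M \<gamma> \<Longrightarrow> has_path_integral M \<A> \<omega> \<gamma> I \<Longrightarrow> path_integral M \<A> \<omega> \<gamma> = I"
  unfolding path_integral_def using has_path_integral_unique by blast

end

lemma has_path_integral_primitive:
  assumes "openin M U" "primitive_on \<A> \<omega> U f" "\<gamma> ` {0..1} \<subseteq> U"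
  shows "has_path_integral M \<A> \<omega> \<gamma> (f (\<gamma> 1) - f (\<gamma> 0))"
  unfolding has_path_integral_def using assms
  by (intro exI[of _ 1] exI[of _ real] exI[of _ "\<lambda>_. U"] exI[of _ "\<lambda>_. f"]) auto

lemma sum_lessThan_add:
  fixes f :: "nat \<Rightarrow> 'b::comm_monoid_add"
  shows "(\<Sum>i<m + n. f i) = (\<Sum>i<m. f i) + (\<Sum>i<n. f (m + i))"
  by (induction n) (auto simp: add.assoc)

lemma has_path_integral_join:
  assumes "has_path_integral M \<A> \<omega> \<gamma> I" "has_path_integral M \<A> \<omega> \<delta> J" and eq: "\<gamma> 1 = \<delta> 0"
  shows "has_path_integral M \<A> \<omega> (\<lambda>s. if s \<le> 1/2 then \<gamma> (2 * s) else \<delta> (2 * s - 1)) (I + J)"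
    (is "has_path_integral M \<A> \<omega> ?h _")
proof -
  obtain m and t :: "nat \<Rightarrow> real" and U f where t: "t 0 = 0" "t m = 1" "\<And>i. i < m \<Longrightarrow> t i < t (Suc i)"
    and U: "\<And>i. i < m \<Longrightarrow> openin M (U i) \<and> \<gamma> ` {t i..t (Suc i)} \<subseteq> U i \<and> primitive_on \<A> \<omega> (U i) (f i)"
    and I: "I = (\<Sum>i<m. f i (\<gamma> (t (Suc i))) - f i (\<gamma> (t i)))"
    using assms(1) unfolding has_path_integral_def by blast
  obtain n and t' :: "nat \<Rightarrow> real" and U' f' where t': "t' 0 = 0" "t' n = 1" "\<And>i. i < n \<Longrightarrow> t' i < t' (Suc i)"
    and U': "\<And>i. i < n \<Longrightarrow> openin M (U' i) \<and> \<delta> ` {t' i..t' (Suc i)} \<subseteq> U' i \<and> primitive_on \<A> \<omega> (U' i) (f' i)"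
    and J: "J = (\<Sum>i<n. f' i (\<delta> (t' (Suc i))) - f' i (\<delta> (t' i)))"
    using assms(2) unfolding has_path_integral_def by blast
  define h where "h = ?h"
  \<comment> \<open>At \<open>i = m\<close> both formulas give 1/2, because \<open>t m = 1\<close>
    and \<open>t' 0 = 0\<close>; hence \<open>T2\<close> holds for \<open>i = 0\<close> as
    well.\<close>
  define T where "T = (\<lambda>i. if i \<le> m then t i / 2 else (1 + t' (i - m)) / 2)"
  define V where "V = (\<lambda>i. if i < m then U i else U' (i - m))"
  define g where "g = (\<lambda>i. if i < m then f i else f' (i - m))"
  have T1: "T i = t i / 2" if "i \<le> m" for i using that by (simp add: T_def)
  have T2: "T (m + i) = (1 + t' i) / 2" for i using t(2) t'(1) by (simp add: T_def)
  have mono: "t i \<le> t m" if "i \<le> m" for i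
    using that
  proof (induction rule: inc_induct)
    case (step i) then show ?case using t(3)[of i] by auto
  qed auto
  have mono': "t' 0 \<le> t' i" if "i \<le> n" for i
    using that
  proof (induction i)
    case (Suc i) then show ?case using t'(3)[of i] by auto
  qed auto
  have h1: "h s = \<gamma> (2 * s)" if "s \<le> 1/2" for s using that by (simp add: h_def)
  have h2: "h s = \<delta> (2 * s - 1)" if "s \<ge> 1/2" for s
  proof (cases "s = 1/2")
    case True show ?thesis unfolding True by (simp add: eq h_def)
  qed (use that in \<open>auto simp: h_def\<close>)
  have h3: "h ((1 + x) / 2) = \<delta> x" if "0 \<le> x" for x
  proof -
    have "2 * ((1 + x) / 2) - 1 = x" by (simp add: field_simps)
    then show ?thesis using h2[of "(1 + x) / 2"] that by (simp only:)
  qed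
  have cases: "P i" if "i < m + n" "\<And>i. i < m \<Longrightarrow> P i" "\<And>i. i < n \<Longrightarrow> P (m + i)" for P and i :: nat
    using that by (metis add_diff_inverse_nat nat_add_left_cancel_less)
  have Tmono: "T i < T (Suc i)" if "i < m + n" for i
    using that
  proof (rule cases)
    fix i assume "i < m" then show "T i < T (Suc i)" using t(3) by (simp add: T1)
  next
    fix i assume "i < n" then show "T (m + i) < T (Suc (m + i))"
      using t'(3)[of i] T2[of i] T2[of "Suc i"] by simp
  qed
  have VV: "openin M (V i) \<and> h ` {T i..T (Suc i)} \<subseteq> V i \<and> primitive_on \<A> \<omega> (V i) (g i)" if "i < m + n" for i
    using that
  proof (rule cases)
    fix i assume i: "i < m"
    have "h s \<in> U i" if "s \<in> {T i..T (Suc i)}" for s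
    proof -
      have s: "2 * s \<in> {t i..t (Suc i)}" using that i by (auto simp: T1)
      then have "s \<le> 1/2" using mono[of "Suc i"] i t by auto
      then show ?thesis using h1 U[OF i] s by auto
    qed
    then show "openin M (V i) \<and> h ` {T i..T (Suc i)} \<subseteq> V i \<and> primitive_on \<A> \<omega> (V i) (g i)"
      using U[OF i] i by (auto simp: V_def g_def)
  next
    fix i assume i: "i < n"
    have "h s \<in> U' i" if "s \<in> {T (m + i)..T (Suc (m + i))}" for s
    proof -
      have s: "2 * s - 1 \<in> {t' i..t' (Suc i)}" using that i T2[of i] T2[of "Suc i"] by auto
      then have "s \<ge> 1/2" using mono'[of i] i t' by auto
      then show ?thesis using h2 U'[OF i] s by auto
    qed
    then show "openin M (V (m + i)) \<and> h ` {T (m + i)..T (Suc (m + i))} \<subseteq> V (m + i) \<and> primitive_on \<A> \<omega> (V (m + i)) (g (m + i))"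
      using U'[OF i] i by (auto simp: V_def g_def)
  qed
  have "(\<Sum>i<m. g i (h (T (Suc i))) - g i (h (T i))) = I"
    unfolding I
  proof (rule sum.cong)
    fix i assume "i \<in> {..<m}"
    then have i: "i < m" by simp
    have "h (T (Suc i)) = \<gamma> (t (Suc i))" "h (T i) = \<gamma> (t i)"
      using h1[of "T (Suc i)"] h1[of "T i"] mono[of "Suc i"] mono[of i] i t(2) by (auto simp: T1)
    then show "g i (h (T (Suc i))) - g i (h (T i)) = f i (\<gamma> (t (Suc i))) - f i (\<gamma> (t i))"
      using i by (simp only: g_def if_True)
  qed simp
  moreover have "(\<Sum>i<n. g (m + i) (h (T (Suc (m + i)))) - g (m + i) (h (T (m + i)))) = J"
    unfolding J
  proof (rule sum.cong)
    fix i assume "i \<in> {..<n}"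
    then have i: "i < n" by simp
    have "h (T (Suc (m + i))) = \<delta> (t' (Suc i))" "h (T (m + i)) = \<delta> (t' i)"
      using h3[of "t' (Suc i)"] h3[of "t' i"] mono'[of "Suc i"] mono'[of i] i t'(1)
      unfolding T2 add_Suc_right[symmetric] by auto
    moreover have "g (m + i) = f' i" by (simp add: g_def)
    ultimately show "g (m + i) (h (T (Suc (m + i)))) - g (m + i) (h (T (m + i))) = f' i (\<delta> (t' (Suc i))) - f' i (\<delta> (t' i))"
      by (simp only:)
  qed simp
  ultimately have "I + J = (\<Sum>i<m + n. g i (h (T (Suc i))) - g i (h (T i)))"
    unfolding sum_lessThan_add by simp
  moreover have "T 0 = 0" "T (m + n) = 1" using T1[of 0] T2[of n] t t' by auto
  ultimately show ?thesis
    unfolding has_path_integral_def h_def[symmetric] using Tmono VV by blast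
qed

section \<open>Deformations along a nowhere vanishing closed form\<close>

text \<open>The primitive is the integral of \<open>a\<close> along the segments from the centre,
  differentiated under the integral sign. Closedness turns the derivative of the integrand in
  direction \<open>w\<close> into the derivative of \<open>t * a (P t x) w\<close> with respect to
  \<open>t\<close>, which integrates to \<open>a x w\<close>.\<close>

lemma poincare_ball:
  fixes a :: "'e::euclidean_space \<Rightarrow> 'e \<Rightarrow> real"
  assumes lin: "\<And>x. x \<in> ball p r \<Longrightarrow> linear (a x)"
    and smooth: "\<And>v. smooth_on (\<lambda>x. a x v) (ball p r)"
    and closed: "\<And>x v w. x \<in> ball p r \<Longrightarrow>
      frechet_derivative (\<lambda>y. a y w) (at x) v = frechet_derivative (\<lambda>y. a y v) (at x) w"
  shows "\<exists>g. \<forall>x\<in>ball p r. (g has_derivative a x) (at x)"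
proof -
  define P where "P = (\<lambda>t x. p + t *\<^sub>R (x - p))"
  define d where "d = (\<lambda>w y v. frechet_derivative (\<lambda>x. a x w) (at y) v)"
  have P: "P t x \<in> ball p r" if "x \<in> ball p r" "t \<in> {0..1}" for t x
  proof -
    have "dist p (P t x) = \<bar>t\<bar> * dist p x" by (simp add: P_def dist_norm norm_minus_commute)
    also have "\<dots> \<le> dist p x" using that mult_right_mono[of t 1 "dist p x"] by simp
    finally show ?thesis using that by simp
  qed
  have lin_d: "linear (d w y)" if "y \<in> ball p r" for w y
    unfolding d_def using has_derivative_linear smooth_on_has_derivative[OF smooth that] by blast
  have lin_d': "linear (\<lambda>w. d w y v)" if "y \<in> ball p r" for v y
    unfolding d_def
    by (rule linear_frechet_derivative_family[OF open_ball that lin smooth_on_differentiable[OF smooth that]])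
  \<comment> \<open>The Leibniz rule wants the derivative as a continuous family of bounded linear
    maps. Closedness is already built in: direct differentiation yields
    \<open>d (x - p) (P t x) w\<close>, with the slots of \<open>w\<close> and \<open>x - p\<close>
    exchanged.\<close>
  define F' where "F' = (\<lambda>x t. Blinfun (\<lambda>w. t * d w (P t x) (x - p) + a (P t x) w))"
  have F': "blinfun_apply (F' x t) = (\<lambda>w. t * d w (P t x) (x - p) + a (P t x) w)"
    if "x \<in> ball p r" "t \<in> {0..1}" for x t
  proof -
    have "linear (\<lambda>w. t * d w (P t x) (x - p) + a (P t x) w)"
      using linear_compose_add[OF linear_compose_scale_right[OF lin_d'[OF P[OF that]], of t "x - p"] lin[OF P[OF that]]]
      by simp
    then show ?thesis unfolding F'_def by (simp add: bounded_linear_Blinfun_apply linear_conv_bounded_linear)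
  qed
  have der: "((\<lambda>x. a (P t x) (x - p)) has_derivative blinfun_apply (F' x t)) (at x within ball p r)"
    if x: "x \<in> ball p r" and t: "t \<in> cbox 0 1" for x t
  proof -
    have t': "t \<in> {0..1}" using t by simp
    have P_der: "(P t has_derivative (\<lambda>w. t *\<^sub>R w)) (at x)"
      unfolding P_def by (auto intro!: derivative_eq_intros)
    have comp: "((\<lambda>y. a (P t y) b) has_derivative (\<lambda>w. d b (P t x) (t *\<^sub>R w))) (at x)" for b
      unfolding d_def
      by (rule has_derivative_compose[OF P_der smooth_on_has_derivative[OF smooth P[OF x t']]])
    have "((\<lambda>y. y - p) has_derivative (\<lambda>w. w)) (at x)" by (auto intro!: derivative_eq_intros)
    note X = differentiableI[OF this] frechet_derivative_at[OF this, symmetric]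
    have "((\<lambda>y. a (P t y) (y - p)) has_derivative
      (\<lambda>w. frechet_derivative (\<lambda>y. a (P t y) (x - p)) (at x) w + a (P t x) (frechet_derivative (\<lambda>y. y - p) (at x) w))) (at x)"
      by (rule has_derivative_linear_family[where A="\<lambda>y. a (P t y)", OF open_ball x lin[OF P[OF _ t']] differentiableI[OF comp] X(1)])
    moreover have "frechet_derivative (\<lambda>y. a (P t y) (x - p)) (at x) w = t * d w (P t x) (x - p)" for w
      unfolding frechet_derivative_apply[OF comp] using linear_cmul[OF lin_d[OF P[OF x t']]]
        closed[OF P[OF x t'], of "x - p" w] by (simp add: d_def)
    ultimately show ?thesis unfolding F'[OF x t'] X(2) by (auto intro: has_derivative_at_withinI)
  qed
  have cont_a: "continuous_on (ball p r) (\<lambda>y. a y w)" for w by (rule smooth_on_continuous_on[OF smooth])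
  have cont_d: "continuous_on (ball p r) (\<lambda>y. d w y v)" for w v
    unfolding d_def by (rule smooth_on_continuous_on[OF smooth_on_frechet_derivative[OF smooth]])
  have cont: "continuous_on (ball p r \<times> cbox 0 1) (\<lambda>(x, t). F' x t)"
  proof (rule continuous_on_blinfun_componentwise)
    fix w :: 'e
    have PP: "continuous_on (ball p r \<times> cbox 0 1) (\<lambda>z. P (snd z) (fst z))"
      unfolding P_def by (intro continuous_intros)
    have sub: "(\<lambda>z. P (snd z) (fst z)) ` (ball p r \<times> cbox 0 1) \<subseteq> ball p r" using P by auto
    have "continuous_on (ball p r \<times> cbox 0 1)
      (\<lambda>z. snd z * (\<Sum>b\<in>Basis. ((fst z - p) \<bullet> b) * d w (P (snd z) (fst z)) b) + a (P (snd z) (fst z)) w)"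
      by (intro continuous_intros continuous_on_compose2[OF cont_d PP sub] continuous_on_compose2[OF cont_a PP sub])
    moreover have "snd z * (\<Sum>b\<in>Basis. ((fst z - p) \<bullet> b) * d w (P (snd z) (fst z)) b) + a (P (snd z) (fst z)) w
       = blinfun_apply (case z of (x, t) \<Rightarrow> F' x t) w" if "z \<in> ball p r \<times> cbox 0 1" for z
      using that by (auto simp: F' linear_basis_expansion[OF lin_d[OF P], symmetric])
    ultimately show "continuous_on (ball p r \<times> cbox 0 1) (\<lambda>z. blinfun_apply (case z of (x, t) \<Rightarrow> F' x t) w)"
      by (rule continuous_on_eq)
  qed
  have int: "(\<lambda>t. a (P t x) (x - p)) integrable_on cbox 0 1" if "x \<in> ball p r" for x
  proof (rule integrable_continuous)
    show "continuous_on (cbox 0 1) (\<lambda>t. a (P t x) (x - p))"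
      using P[OF that] by (intro continuous_on_compose2[OF cont_a]) (auto simp: P_def intro!: continuous_intros)
  qed
  define g where "g = (\<lambda>x. integral (cbox 0 1) (\<lambda>t. a (P t x) (x - p)))"
  have "(g has_derivative a x) (at x)" if x: "x \<in> ball p r" for x
  proof -
    have "(g has_derivative integral (cbox 0 1) (F' x)) (at x within ball p r)"
      unfolding g_def using der by (intro leibniz_rule[OF _ int cont x convex_ball]) auto
    moreover have "blinfun_apply (integral (cbox 0 1) (F' x)) w = a x w" for w
    proof -
      have "continuous_on (cbox 0 1) (F' x)"
      proof -
        have pair: "continuous_on (cbox 0 1) (\<lambda>t::real. (x, t))" by (intro continuous_intros)
        have "(\<lambda>t. (x, t)) ` cbox 0 1 \<subseteq> ball p r \<times> cbox 0 1" using x by auto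
        from continuous_on_compose2[OF cont pair this] show ?thesis by simp
      qed
      then have "F' x integrable_on cbox 0 1" by (rule integrable_continuous)
      then have eq: "blinfun_apply (integral (cbox 0 1) (F' x)) w = integral (cbox 0 1) (\<lambda>t. blinfun_apply (F' x t) w)"
        by (rule blinfun_apply_integral)
      have "((\<lambda>t. blinfun_apply (F' x t) w) has_integral (1 * a (P 1 x) w - 0 * a (P 0 x) w)) {0..1}"
      proof (rule fundamental_theorem_of_calculus)
        fix t :: real assume t: "t \<in> {0..1}"
        have P_der: "((\<lambda>t. P t x) has_derivative (\<lambda>h. h *\<^sub>R (x - p))) (at t)"
          unfolding P_def by (auto intro!: derivative_eq_intros)
        have "((\<lambda>t. a (P t x) w) has_derivative (\<lambda>h. d w (P t x) (h *\<^sub>R (x - p)))) (at t)"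
          unfolding d_def
          by (rule has_derivative_compose[OF P_der smooth_on_has_derivative[OF smooth P[OF x t]]])
        note D = has_derivative_mult[OF has_derivative_ident this]
        show "((\<lambda>t. t * a (P t x) w) has_vector_derivative blinfun_apply (F' x t) w) (at t within {0..1})"
          unfolding has_vector_derivative_def F'[OF x t]
          by (rule has_derivative_eq_rhs[OF has_derivative_at_withinI[OF D]])
            (simp add: linear_cmul[OF lin_d[OF P[OF x t]]] distrib_left mult.left_commute)
      qed simp
      then have "integral (cbox 0 1) (\<lambda>t. blinfun_apply (F' x t) w) = a (P 1 x) w" by auto
      then show ?thesis using eq by (simp add: P_def)
    qed
    then have "blinfun_apply (integral (cbox 0 1) (F' x)) = a x" by (rule ext)
    ultimately show ?thesis
      using at_within_open[OF x open_ball] by simp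
  qed
  then show ?thesis by blast
qed

lemma (in manifold) chart_primitive_exists:
  assumes "closed_one_form \<A> \<omega>" and c: "c \<in> \<A>" and sub: "ball u r \<subseteq> chart_image c"
  shows "\<exists>g. \<forall>x\<in>ball u r. (g has_derivative \<omega> c x) (at x)"
proof (rule poincare_ball)
  show "linear (\<omega> c x)" if "x \<in> ball u r" for x
    using assms that unfolding closed_one_form_def one_form_def by blast
  show "smooth_on (\<lambda>x. \<omega> c x v) (ball u r)" for v
  proof -
    have "cont_diff_on k (\<lambda>x. \<omega> c x v) (chart_image c)" for k
      using assms unfolding closed_one_form_def one_form_def smooth_on_def by blast
    then show ?thesis
      unfolding smooth_on_def using cont_diff_on_subset[OF _ sub] by blast
  qed
  show "frechet_derivative (\<lambda>y. \<omega> c y w) (at x) v = frechet_derivative (\<lambda>y. \<omega> c y v) (at x) w"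
    if "x \<in> ball u r" for x v w
  proof -
    have "x \<in> chart_image c" using that sub by blast
    then have "d1 \<omega> c x v w = 0" using assms(1) c unfolding closed_one_form_def by blast
    then show ?thesis by (simp add: d1_def)
  qed
qed

lemma (in manifold) primitive_exists:
  assumes \<omega>: "closed_one_form \<A> \<omega>" and "x \<in> topspace M"
  shows "\<exists>U f. openin M U \<and> x \<in> U \<and> primitive_on \<A> \<omega> U f"
proof -
  obtain c where c: "c \<in> \<A>" "x \<in> chart_dom c" using chart_exists assms(2) by blast
  obtain r where r: "r > 0" "ball (chart_map c x) r \<subseteq> chart_image c"
    using open_chart_image[OF c(1)] chart_map_in_image[OF c(2)] openE by blast
  obtain g where "\<forall>u\<in>ball (chart_map c x) r. (g has_derivative \<omega> c u) (at u)"
    using chart_primitive_exists[OF \<omega> c(1) r(2)] by blast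
  then have "primitive_on \<A> \<omega> {y \<in> chart_dom c. chart_map c y \<in> ball (chart_map c x) r} (g \<circ> chart_map c)"
    using \<omega> by (intro primitive_on_chart c r) (auto simp: closed_one_form_def)
  moreover have "openin M {y \<in> chart_dom c. chart_map c y \<in> ball (chart_map c x) r}"
    by (rule openin_chart_preimage[OF c(1) open_ball])
  moreover have "x \<in> {y \<in> chart_dom c. chart_map c y \<in> ball (chart_map c x) r}" using c r by simp
  ultimately show ?thesis by blast
qed

section \<open>Pushes inside charts and their composition\<close>

text \<open>The homotopy is hidden: later arguments use only its end map \<open>e\<close> and the
  integrals \<open>D\<close> along the tracks of points, and both obey a simple rule under
  composition.\<close>

definition deforms ::
  "'a topology \<Rightarrow> ('a, 'e::euclidean_space) chart set \<Rightarrow> ('a, 'e) form1 \<Rightarrow> ('a \<Rightarrow> 'a) \<Rightarrow> ('a \<Rightarrow> real) \<Rightarrow> bool" where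
  "deforms M \<A> \<omega> e D \<longleftrightarrow>
     (\<exists>H. continuous_map (prod_topology (top_of_set {0..1}) M) M (\<lambda>(t, x). H t x) \<and>
        (\<forall>x\<in>topspace M. H (0::real) x = x \<and> H 1 x = e x \<and> has_path_integral M \<A> \<omega> (\<lambda>t. H t x) (D x)))"

text \<open>Push against a constant vector field of the chart on which \<open>\<omega>\<close> is positive, with a speed
  cut off outside a small ball: a local primitive of \<open>\<omega>\<close> decreases strictly along every
  path that moves.\<close>
lemma (in manifold) push_chart:
  assumes \<omega>: "closed_one_form \<A> \<omega>" and c: "c \<in> \<A>" and p: "p \<in> chart_dom c"
    and v0: "\<omega> c (chart_map c p) v0 \<noteq> 0"
  shows "\<exists>e D V. openin M V \<and> p \<in> V \<and> deforms M \<A> \<omega> e D \<and> continuous_map M euclideanreal D \<and>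
    (\<forall>x\<in>topspace M. D x \<le> 0 \<and> (D x = 0 \<longrightarrow> e x = x)) \<and> (\<forall>x\<in>V. D x < 0)"
proof -
  define u where "u = chart_map c p"
  have u: "u \<in> chart_image c" using p by (auto simp: u_def)
  have lin: "linear (\<omega> c u)" using \<omega> c u unfolding closed_one_form_def one_form_def by blast
  define v1 where "v1 = (if \<omega> c u v0 > 0 then v0 else - v0)"
  have v1: "\<omega> c u v1 > 0" using v0 linear_neg[OF lin, of v0] by (auto simp: v1_def u_def)
  then have "v1 \<noteq> 0" using linear_0[OF lin] by auto
  \<comment> \<open>Length 1/2 makes a push by at most \<open>k x\<close> move \<open>x\<close> by
    at most half its distance to the sphere of radius \<open>r / 2\<close>, so it cannot leave
    \<open>ball u r\<close>.\<close>
  define v where "v = (1 / (2 * norm v1)) *\<^sub>R v1"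
  have v: "norm v = 1 / 2" "\<omega> c u v > 0"
    using \<open>v1 \<noteq> 0\<close> v1 by (auto simp: v_def linear_cmul[OF lin])
  have "continuous_on (chart_image c) (\<lambda>x. \<omega> c x v)"
    using \<omega> c smooth_on_continuous_on unfolding closed_one_form_def one_form_def by blast
  then have "open ({x \<in> chart_image c. \<omega> c x v \<in> {0<..}})"
    by (intro continuous_open_preimage[OF _ open_chart_image[OF c], unfolded vimage_def Int_def mem_Collect_eq]) auto
  then obtain r where r: "r > 0" "ball u r \<subseteq> {x \<in> chart_image c. \<omega> c x v \<in> {0<..}}"
    using u v by (auto elim!: openE[where x=u])
  have ball: "ball u r \<subseteq> chart_image c" and pos: "\<And>x. x \<in> ball u r \<Longrightarrow> \<omega> c x v > 0"
    using r(2) by auto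
  obtain g where g: "\<And>x. x \<in> ball u r \<Longrightarrow> (g has_derivative \<omega> c x) (at x)"
    using chart_primitive_exists[OF \<omega> c ball] by blast
  \<comment> \<open>A continuous cutoff, positive exactly on \<open>ball u (r / 2)\<close>. It need
    not be smooth, since only continuity of the homotopy is asked for.\<close>
  define k where "k = (\<lambda>x. max 0 (r / 2 - dist u x))"
  define \<psi> where "\<psi> = (\<lambda>t x. x - (t * k x) *\<^sub>R v)"
  have step: "x - s *\<^sub>R v \<in> ball u r" if "x \<in> ball u r" "0 \<le> s" "s \<le> k x" for x s
  proof -
    have "dist u (x - s *\<^sub>R v) \<le> dist u x + norm (s *\<^sub>R v)"
      using dist_triangle[of u "x - s *\<^sub>R v" x] by (simp add: dist_norm)
    also have "norm (s *\<^sub>R v) = s / 2" using that v by simp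
    finally show ?thesis using that r(1) by (auto simp: k_def max_def split: if_splits)
  qed
  have \<psi>_ball: "\<psi> t x \<in> ball u r" if "x \<in> ball u r" "t \<in> {0..1}" for t x
    unfolding \<psi>_def using that mult_right_mono[of t 1 "k x"] by (intro step) (auto simp: k_def)
  have \<psi>_id: "\<psi> t x = x" if "k x = 0" for t x using that by (simp add: \<psi>_def)
  have \<psi>_0: "\<psi> 0 x = x" for x by (simp add: \<psi>_def)
  \<comment> \<open>The segment traversed stays in the ball, where \<omega> is positive on
    \<open>v\<close>; so \<open>g\<close> has negative derivative along it, and the mean value
    theorem gives a strict decrease.\<close>
  have dec: "g (\<psi> 1 x) < g x" if x: "x \<in> ball u r" and "k x > 0" for x
  proof -
    have "\<exists>s\<in>{0<..<k x}. g (x - k x *\<^sub>R v) - g (x - 0 *\<^sub>R v) = \<omega> c (x - s *\<^sub>R v) ((- (k x - 0)) *\<^sub>R v)"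
    proof (rule mvt_simple[OF \<open>k x > 0\<close>])
      fix s assume s: "0 \<le> s" "s \<le> k x"
      have "((\<lambda>s. x - s *\<^sub>R v) has_derivative (\<lambda>h. (- h) *\<^sub>R v)) (at s within {0..k x})"
        by (auto intro!: derivative_eq_intros)
      from has_derivative_compose[OF this g[OF step[OF x s]]]
      show "((\<lambda>s. g (x - s *\<^sub>R v)) has_derivative (\<lambda>h. \<omega> c (x - s *\<^sub>R v) ((- h) *\<^sub>R v))) (at s within {0..k x})" .
    qed
    then obtain s where s: "0 < s" "s < k x"
      "g (x - k x *\<^sub>R v) - g x = \<omega> c (x - s *\<^sub>R v) ((- k x) *\<^sub>R v)" by auto
    have b: "x - s *\<^sub>R v \<in> ball u r" using step[OF x, of s] s by simp
    then have "linear (\<omega> c (x - s *\<^sub>R v))"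
      using \<omega> c ball unfolding closed_one_form_def one_form_def by blast
    then have "\<omega> c (x - s *\<^sub>R v) ((- k x) *\<^sub>R v) = - (k x * \<omega> c (x - s *\<^sub>R v) v)"
      by (simp add: linear_cmul linear_neg)
    moreover have "k x * \<omega> c (x - s *\<^sub>R v) v > 0"
      using pos[OF b] \<open>k x > 0\<close> by (rule mult_pos_pos[rotated])
    ultimately show ?thesis using s by (simp add: \<psi>_def)
  qed
  define A where "A = {x \<in> chart_dom c. chart_map c x \<in> ball u r}"
  \<comment> \<open>\<open>B\<close> is open because the removed set is compact in a Hausdorff
    space. On \<open>A \<inter> B\<close> the cutoff vanishes, so the push on \<open>A\<close> and
    the identity on \<open>B\<close> can be pasted.\<close>
  define B where "B = topspace M - chart_inv c ` cball u (r / 2)"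
  have opA: "openin M A" unfolding A_def by (rule openin_chart_preimage[OF c open_ball])
  have invA: "chart_inv c y \<in> A" "chart_map c (chart_inv c y) = y" if "y \<in> ball u r" for y
  proof -
    have "y \<in> chart_image c" using that ball by blast
    then show "chart_inv c y \<in> A" "chart_map c (chart_inv c y) = y" using that by (auto simp: A_def)
  qed
  have cb: "cball u (r / 2) \<subseteq> ball u r" using r(1) by auto
  have opB: "openin M B"
  proof -
    have "compactin (top_of_set (chart_image c)) (cball u (r / 2))"
      using cb ball by (simp add: compactin_subtopology)
    then have "compactin M (chart_inv c ` cball u (r / 2))"
      using continuous_map_chart_inv[OF c] by (rule image_compactin)
    then have "closedin M (chart_inv c ` cball u (r / 2))"
      using smooth_manifold by (intro compactin_imp_closedin) (auto simp: smooth_manifold_def)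
    then show ?thesis unfolding B_def by (rule openin_diff[OF openin_topspace])
  qed
  have k0: "k (chart_map c x) = 0" if "x \<in> A" "x \<in> B" for x
  proof (rule ccontr)
    assume "k (chart_map c x) \<noteq> 0"
    then have "chart_map c x \<in> cball u (r / 2)" by (auto simp: k_def max_def split: if_splits)
    then have "chart_inv c (chart_map c x) \<in> chart_inv c ` cball u (r / 2)" by (rule imageI)
    then show False using that c by (simp add: A_def B_def)
  qed
  have AB: "x \<in> A \<or> x \<in> B" if x: "x \<in> topspace M" for x
  proof (rule ccontr)
    assume *: "\<not> ?thesis"
    then obtain y where "y \<in> cball u (r / 2)" "x = chart_inv c y" using x by (auto simp: B_def)
    then have "x \<in> A" using cb invA by blast
    then show False using * by blast
  qed
  define H where "H = (\<lambda>t x. if x \<in> A then chart_inv c (\<psi> t (chart_map c x)) else x)"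
  define D where "D = (\<lambda>x. if x \<in> A then g (\<psi> 1 (chart_map c x)) - g (chart_map c x) else 0)"
  let ?I = "top_of_set {0..1::real}"
  have cont_k: "continuous_on UNIV k" unfolding k_def by (intro continuous_intros)
  have cont_chart: "continuous_map (subtopology M A) (top_of_set (ball u r)) (chart_map c)"
    using continuous_map_from_subtopology_mono[OF continuous_map_chart[OF c], of A]
    by (auto simp: continuous_map_in_subtopology A_def)
  have "continuous_map (prod_topology ?I M) M (\<lambda>(t, x). H t x)"
  proof (rule pasting_lemma[where I="{True, False}" and T="\<lambda>b. topspace ?I \<times> (if b then A else B)"
        and f="\<lambda>b. if b then (\<lambda>(t, x). H t x) else snd"])
    show "openin (prod_topology ?I M) (topspace ?I \<times> (if b then A else B))" for b
      using opA opB by (simp add: openin_prod_Times_iff)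
    have "continuous_map (prod_topology ?I (subtopology M A)) (prod_topology ?I (top_of_set (ball u r)))
        (\<lambda>(t, x). (id t, chart_map c x))"
      unfolding continuous_map_prod_top using cont_chart by simp
    moreover have "continuous_on ({0..1} \<times> ball u r) (\<lambda>(t, x). \<psi> t x)"
      unfolding \<psi>_def case_prod_beta
      by (intro continuous_intros continuous_on_compose2[OF cont_k]) auto
    then have "continuous_map (prod_topology ?I (top_of_set (ball u r))) (top_of_set (chart_image c)) (\<lambda>(t, x). \<psi> t x)"
      using \<psi>_ball ball
      by (auto simp: subtopology_Times[symmetric] continuous_map_in_subtopology)
    ultimately have "continuous_map (prod_topology ?I (subtopology M A)) M
        (chart_inv c \<circ> ((\<lambda>(t, x). \<psi> t x) \<circ> (\<lambda>(t, x). (id t, chart_map c x))))"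
      using continuous_map_chart_inv[OF c] by (intro continuous_map_compose)
    then have HA: "continuous_map (prod_topology ?I (subtopology M A)) M (\<lambda>(t, x). H t x)"
      by (rule continuous_map_eq) (auto simp: H_def)
    have HB: "continuous_map (prod_topology ?I (subtopology M B)) M snd"
      using continuous_map_snd continuous_map_into_fulltopology by blast
    show "continuous_map (subtopology (prod_topology ?I M) (topspace ?I \<times> (if b then A else B))) M
        (if b then (\<lambda>(t, x). H t x) else snd)" for b
      using HA HB by (simp add: subtopology_Times subtopology_subtopology)
    show "(if i then (\<lambda>(t, x). H t x) else snd) z = (if j then (\<lambda>(t, x). H t x) else snd) z"
      if "i \<in> {True, False}" "j \<in> {True, False}"
        "z \<in> topspace (prod_topology ?I M) \<inter> (topspace ?I \<times> (if i then A else B)) \<inter> (topspace ?I \<times> (if j then A else B))"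
      for i j z
      using that k0 c by (auto simp: H_def \<psi>_id A_def split: if_splits)
    show "\<exists>j. j \<in> {True, False} \<and> z \<in> topspace ?I \<times> (if j then A else B) \<and>
        (\<lambda>(t, x). H t x) z = (if j then (\<lambda>(t, x). H t x) else snd) z"
      if z: "z \<in> topspace (prod_topology ?I M)" for z
    proof (cases "snd z \<in> A")
      case True then show ?thesis using z by (intro exI[of _ True]) auto
    next
      case False
      then have "snd z \<in> B" using z AB[of "snd z"] by auto
      then show ?thesis using z False by (intro exI[of _ False]) (auto simp: H_def)
    qed
  qed
  moreover have "H 0 x = x \<and> H 1 x = H 1 x \<and> has_path_integral M \<A> \<omega> (\<lambda>t. H t x) (D x)" if x: "x \<in> topspace M" for x
  proof (cases "x \<in> A")
    case True
    then have xA: "x \<in> chart_dom c" "chart_map c x \<in> ball u r" by (auto simp: A_def)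
    have "primitive_on \<A> \<omega> A (g \<circ> chart_map c)"
      unfolding A_def using \<omega> g by (intro primitive_on_chart c ball) (auto simp: closed_one_form_def)
    moreover have "(\<lambda>t. H t x) ` {0..1} \<subseteq> A"
      using True invA(1)[OF \<psi>_ball[OF xA(2)]] by (auto simp: H_def)
    ultimately have "has_path_integral M \<A> \<omega> (\<lambda>t. H t x) ((g \<circ> chart_map c) (H 1 x) - (g \<circ> chart_map c) (H 0 x))"
      by (rule has_path_integral_primitive[OF opA])
    moreover have "chart_map c (H 1 x) = \<psi> 1 (chart_map c x)"
      using True invA(2)[OF \<psi>_ball[OF xA(2), of 1]] by (simp add: H_def)
    moreover have "H 0 x = x" using True xA c by (simp add: H_def \<psi>_0)
    ultimately show ?thesis using True by (simp add: D_def)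
  next
    case False
    \<comment> \<open>Here the track is constant, and any primitive near \<open>x\<close> certifies
      the value 0.\<close>
    obtain U f where "openin M U" "x \<in> U" "primitive_on \<A> \<omega> U f" using primitive_exists[OF \<omega> x] by blast
    then have "has_path_integral M \<A> \<omega> (\<lambda>t. H t x) (f (H 1 x) - f (H 0 x))"
      using False by (intro has_path_integral_primitive) (auto simp: H_def)
    then show ?thesis using False by (simp add: H_def D_def)
  qed
  ultimately have deforms: "deforms M \<A> \<omega> (H 1) D" unfolding deforms_def by blast
  have cont_g: "continuous_on (ball u r) g"
    using g by (meson continuous_at_imp_continuous_on has_derivative_continuous)
  have "continuous_map M euclideanreal D"
  proof (rule pasting_lemma[where I="{True, False}" and T="\<lambda>b. if b then A else B"
        and f="\<lambda>b. if b then D else (\<lambda>_. 0)"])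
    show "openin M (if b then A else B)" for b using opA opB by simp
    have "continuous_on (ball u r) (\<lambda>x. g (\<psi> 1 x) - g x)"
    proof (intro continuous_on_diff continuous_on_compose2[OF cont_g] cont_g)
      show "continuous_on (ball u r) (\<psi> 1)"
        unfolding \<psi>_def by (intro continuous_intros continuous_on_compose2[OF cont_k]) auto
      show "\<psi> 1 ` ball u r \<subseteq> ball u r" using \<psi>_ball by auto
    qed auto
    then have "continuous_map (subtopology M A) euclideanreal ((\<lambda>x. g (\<psi> 1 x) - g x) \<circ> chart_map c)"
      using cont_chart by (intro continuous_map_compose) auto
    then have "continuous_map (subtopology M A) euclideanreal D"
      by (rule continuous_map_eq) (auto simp: D_def)
    then show "continuous_map (subtopology M (if b then A else B)) euclideanreal (if b then D else (\<lambda>_. 0))" for b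
      by simp
    show "(if i then D else (\<lambda>_. 0)) z = (if j then D else (\<lambda>_. 0)) z"
      if "i \<in> {True, False}" "j \<in> {True, False}"
        "z \<in> topspace M \<inter> (if i then A else B) \<inter> (if j then A else B)" for i j z
      using that k0 by (auto simp: D_def \<psi>_id split: if_splits)
    show "\<exists>j. j \<in> {True, False} \<and> z \<in> (if j then A else B) \<and> D z = (if j then D else (\<lambda>_. 0)) z"
      if z: "z \<in> topspace M" for z
    proof (cases "z \<in> A")
      case True then show ?thesis by (intro exI[of _ True]) auto
    next
      case False
      then have "z \<in> B" using z AB[of z] by auto
      then show ?thesis using False by (intro exI[of _ False]) (auto simp: D_def)
    qed
  qed
  \<comment> \<open>Where the cutoff is positive, \<open>dec\<close> gives \<open>D x < 0\<close>;
    elsewhere the point does not move at all.\<close>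
  moreover have "D x \<le> 0 \<and> (D x = 0 \<longrightarrow> H 1 x = x)" for x
  proof (cases "x \<in> A \<and> k (chart_map c x) > 0")
    case True
    then show ?thesis using dec[of "chart_map c x"] by (auto simp: D_def A_def)
  next
    case False
    then have "x \<in> A \<Longrightarrow> k (chart_map c x) = 0" by (auto simp: k_def)
    then show ?thesis using c by (auto simp: D_def H_def \<psi>_id A_def)
  qed
  moreover have "openin M {x \<in> chart_dom c. chart_map c x \<in> ball u (r / 2)}"
    by (rule openin_chart_preimage[OF c open_ball])
  moreover have "p \<in> {x \<in> chart_dom c. chart_map c x \<in> ball u (r / 2)}" using p r by (simp add: u_def)
  moreover have "D x < 0" if "x \<in> {x \<in> chart_dom c. chart_map c x \<in> ball u (r / 2)}" for x
    using that dec[of "chart_map c x"] r(1) by (auto simp: D_def A_def k_def)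
  ultimately show ?thesis using deforms by blast
qed

context manifold
begin

lemma deforms_continuous_map:
  assumes "deforms M \<A> \<omega> e D" shows "continuous_map M M e"
proof -
  obtain H where H: "continuous_map (prod_topology (top_of_set {0..1}) M) M (\<lambda>(t, x). H t x)"
    "\<And>x. x \<in> topspace M \<Longrightarrow> H (1::real) x = e x"
    using assms unfolding deforms_def by blast
  have "continuous_map M (prod_topology (top_of_set {0..1::real}) M) (\<lambda>x. (1, x))"
    by (intro continuous_map_pairedI continuous_map_id[unfolded id_def]) simp
  from continuous_map_compose[OF this H(1)] show ?thesis
    by (rule continuous_map_eq) (simp add: H(2))
qed

text \<open>Even a constant path needs a primitive near its point to possess an integral; closedness
  of \<omega> supplies it.\<close>

lemma deforms_id:
  assumes "closed_one_form \<A> \<omega>" shows "deforms M \<A> \<omega> (\<lambda>x. x) (\<lambda>_. 0)"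
proof -
  have "has_path_integral M \<A> \<omega> (\<lambda>_. x) 0" if x: "x \<in> topspace M" for x
  proof -
    obtain U f where "openin M U" "x \<in> U" "primitive_on \<A> \<omega> U f" using primitive_exists[OF assms x] by blast
    then show ?thesis using has_path_integral_primitive[of M U \<A> \<omega> f "\<lambda>_. x"] by auto
  qed
  moreover have "continuous_map (prod_topology (top_of_set {0..1::real}) M) M (\<lambda>(t, x). x)"
    by (rule continuous_map_eq[OF continuous_map_snd]) auto
  ultimately show ?thesis unfolding deforms_def by (intro exI[of _ "\<lambda>_ x. x"]) auto
qed

text \<open>The second homotopy starts at the end of the first track, so its contribution is
  evaluated at \<open>e x\<close>; the two homotopies are run at double speed.\<close>

lemma deforms_compose:
  assumes d: "deforms M \<A> \<omega> e D" and d': "deforms M \<A> \<omega> e' D'"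
  shows "deforms M \<A> \<omega> (e' \<circ> e) (\<lambda>x. D x + D' (e x))"
proof -
  let ?I = "top_of_set {0..1::real}"
  let ?X01 = "prod_topology ?I M"
  obtain H where H: "continuous_map ?X01 M (\<lambda>(t, x). H t x)"
    "\<And>x. x \<in> topspace M \<Longrightarrow> H 0 x = x \<and> H 1 x = e x \<and> has_path_integral M \<A> \<omega> (\<lambda>t. H t x) (D x)"
    using d unfolding deforms_def by blast
  obtain H' where H': "continuous_map ?X01 M (\<lambda>(t, x). H' t x)"
    "\<And>x. x \<in> topspace M \<Longrightarrow> H' 0 x = x \<and> H' 1 x = e' x \<and> has_path_integral M \<A> \<omega> (\<lambda>t. H' t x) (D' x)"
    using d' unfolding deforms_def by blast
  note e = deforms_continuous_map[OF d]
  have eM: "e x \<in> topspace M" if "x \<in> topspace M" for x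
    using e that by (auto simp: continuous_map_def)
  define G where "G = (\<lambda>t x. if t \<le> 1/2 then H (2 * t) x else H' (2 * t - 1) (e x))"
  \<comment> \<open>The time changes \<open>2 * t\<close> and \<open>2 * t - 1\<close> remain in the
    unit interval only on their own half, hence the restriction to \<open>S\<close>.\<close>
  have reparam: "continuous_map (subtopology ?X01 S) ?X01 (\<lambda>y. (r (fst y), snd y))"
    if r: "continuous_on UNIV r" "\<And>y. y \<in> S \<Longrightarrow> fst y \<in> {0..1} \<Longrightarrow> r (fst y) \<in> {0..1}" for S and r :: "real \<Rightarrow> real"
  proof (intro continuous_map_pairedI continuous_map_into_subtopology continuous_map_from_subtopology)
    have "continuous_map ?X01 euclideanreal (r \<circ> fst)"
      using r(1) by (intro continuous_map_compose[OF continuous_map_into_fulltopology[OF continuous_map_fst]]) simp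
    then show "continuous_map ?X01 euclideanreal (\<lambda>y. r (fst y))" by (simp add: o_def)
    show "(\<lambda>y. r (fst y)) \<in> topspace (subtopology ?X01 S) \<rightarrow> {0..1}" using r(2) by fastforce
  qed (rule continuous_map_snd)
  have "continuous_map ?X01 ?X01 (\<lambda>(t, x). (id t, e x))"
    unfolding continuous_map_prod_top using e by simp
  note H'e = continuous_map_compose[OF this H'(1)]
  have "continuous_map ?X01 M (\<lambda>y. if fst y \<le> 1/2 then H (2 * fst y) (snd y) else H' (2 * fst y - 1) (e (snd y)))"
  proof (rule continuous_map_cases_le)
    show "continuous_map ?X01 euclideanreal fst"
      by (rule continuous_map_into_fulltopology[OF continuous_map_fst])
    have "continuous_map (subtopology ?X01 {y \<in> topspace ?X01. fst y \<le> 1/2}) ?X01 (\<lambda>y. (2 * fst y, snd y))"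
      by (rule reparam) (auto intro: continuous_intros)
    from continuous_map_compose[OF this H(1)]
    show "continuous_map (subtopology ?X01 {y \<in> topspace ?X01. fst y \<le> 1/2}) M (\<lambda>y. H (2 * fst y) (snd y))"
      by (simp add: o_def)
    have "continuous_map (subtopology ?X01 {y \<in> topspace ?X01. 1/2 \<le> fst y}) ?X01 (\<lambda>y. (2 * fst y - 1, snd y))"
      by (rule reparam) (auto intro: continuous_intros)
    from continuous_map_compose[OF this H'e]
    show "continuous_map (subtopology ?X01 {y \<in> topspace ?X01. 1/2 \<le> fst y}) M (\<lambda>y. H' (2 * fst y - 1) (e (snd y)))"
      by (simp add: o_def)
    show "H (2 * fst y) (snd y) = H' (2 * fst y - 1) (e (snd y))"
      if y: "y \<in> topspace ?X01" "fst y = 1/2" for y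
    proof -
      obtain x where "y = (1/2, x)" "x \<in> topspace M" using y by (cases y) auto
      then show ?thesis using H(2)[of x] H'(2)[of "e x"] eM[of x] by simp
    qed
  qed simp
  then have "continuous_map ?X01 M (\<lambda>(t, x). G t x)"
    by (rule continuous_map_eq) (auto simp: G_def)
  moreover have "has_path_integral M \<A> \<omega> (\<lambda>t. G t x) (D x + D' (e x))" if "x \<in> topspace M" for x
    unfolding G_def using H(2)[OF that] H'(2)[OF eM[OF that]] by (intro has_path_integral_join) auto
  ultimately show ?thesis
    unfolding deforms_def using H(2) H'(2) eM by (intro exI[of _ G]) (auto simp: G_def)
qed

text \<open>The bound on \<open>D\<close> is uniform over \<open>M\<close>, so what is known about
  the remaining rounds also holds from the moved point \<open>e x\<close>.\<close>

lemma deforms_iterate: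
  assumes \<omega>: "closed_one_form \<A> \<omega>" and d: "deforms M \<A> \<omega> e D"
    and D: "\<And>x. x \<in> topspace M \<Longrightarrow> D x \<le> - \<epsilon>"
  shows "\<exists>e' D'. deforms M \<A> \<omega> e' D' \<and> (\<forall>x\<in>topspace M. D' x \<le> - (real n * \<epsilon>))"
proof (induction n)
  case 0
  then show ?case using deforms_id[OF \<omega>] by (intro exI[of _ "\<lambda>x. x"] exI[of _ "\<lambda>_. 0"]) simp
next
  case (Suc n)
  then obtain e' D' where d': "deforms M \<A> \<omega> e' D'" "\<forall>x\<in>topspace M. D' x \<le> - (real n * \<epsilon>)" by blast
  have "D x + D' (e x) \<le> - (real (Suc n) * \<epsilon>)" if x: "x \<in> topspace M" for x
  proof -
    have "e x \<in> topspace M" using deforms_continuous_map[OF d] x by (auto simp: continuous_map_def)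
    then have "D' (e x) \<le> - (real n * \<epsilon>)" using d'(2) by blast
    then show ?thesis using D[OF x] by (simp add: algebra_simps)
  qed
  then show ?case using deforms_compose[OF d d'(1)] by blast
qed

text \<open>Each push leaves a point fixed or strictly lowers the integral, so the negativity achieved
  on one member of a finite cover survives the subsequent pushes.\<close>
lemma deforms_of_nonvanishing:
  assumes compact: "compact_space M" and \<omega>: "closed_one_form \<A> \<omega>"
    and nz: "\<And>c u. c \<in> \<A> \<Longrightarrow> u \<in> chart_image c \<Longrightarrow> \<exists>v. \<omega> c u v \<noteq> 0"
  shows "\<exists>e D \<epsilon>. 0 < \<epsilon> \<and> deforms M \<A> \<omega> e D \<and> (\<forall>x\<in>topspace M. D x \<le> - \<epsilon>)"
proof -
  \<comment> \<open>The invariant of the induction over the cover: continuity of \<open>D\<close> is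
    kept for the final maximum, and the clause on \<open>D x = 0\<close> for composing
    pushes.\<close>
  define good where "good = (\<lambda>V e D. deforms M \<A> \<omega> e D \<and> continuous_map M euclideanreal D \<and>
    (\<forall>x\<in>topspace M. D x \<le> 0 \<and> (D x = 0 \<longrightarrow> e x = x)) \<and> (\<forall>x\<in>V. D x < (0::real)))"
  define \<U> where "\<U> = {V. openin M V \<and> (\<exists>e D. good V e D)}"
  have cover: "\<exists>V. openin M V \<and> p \<in> V \<and> (\<exists>e D. good V e D)" if p: "p \<in> topspace M" for p
  proof -
    obtain c where c: "c \<in> \<A>" "p \<in> chart_dom c" using chart_exists[OF p] by blast
    then obtain v where "\<omega> c (chart_map c p) v \<noteq> 0" using nz by blast
    from push_chart[OF \<omega> c this] show ?thesis unfolding good_def by blast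
  qed
  have "topspace M \<subseteq> \<Union>\<U>"
  proof
    fix p assume "p \<in> topspace M"
    then obtain V e D where "openin M V" "p \<in> V" "good V e D" using cover by metis
    then show "p \<in> \<Union>\<U>" by (auto simp: \<U>_def)
  qed
  moreover have "compactin M (topspace M)" using compact by (simp add: compact_space_def)
  ultimately obtain \<F> where \<F>: "finite \<F>" "\<F> \<subseteq> \<U>" "topspace M \<subseteq> \<Union>\<F>"
    using compactinD[of M "topspace M" \<U>] unfolding \<U>_def by blast
  have "\<exists>e D. good (\<Union>\<F>) e D"
    using \<F>(1,2)
  proof (induction \<F> rule: finite_induct)
    case empty
    show ?case using deforms_id[OF \<omega>] unfolding good_def
      by (intro exI[of _ "\<lambda>x. x"] exI[of _ "\<lambda>_. 0"]) auto
  next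
    case (insert V \<F>)
    obtain e D where g: "good (\<Union>\<F>) e D" using insert by auto
    obtain e' D' where g': "good V e' D'" and V: "openin M V" using insert.prems unfolding \<U>_def by auto
    have D: "deforms M \<A> \<omega> e D" "continuous_map M euclideanreal D"
      "\<And>x. x \<in> topspace M \<Longrightarrow> D x \<le> 0 \<and> (D x = 0 \<longrightarrow> e x = x)" "\<And>x. x \<in> \<Union>\<F> \<Longrightarrow> D x < 0"
      using g unfolding good_def by blast+
    have D': "deforms M \<A> \<omega> e' D'" "continuous_map M euclideanreal D'"
      "\<And>x. x \<in> topspace M \<Longrightarrow> D' x \<le> 0 \<and> (D' x = 0 \<longrightarrow> e' x = x)" "\<And>x. x \<in> V \<Longrightarrow> D' x < 0"
      using g' unfolding good_def by blast+
    note e = deforms_continuous_map[OF D(1)]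
    have eM: "e x \<in> topspace M" if "x \<in> topspace M" for x using e that by (auto simp: continuous_map_def)
    have sub: "\<Union>(insert V \<F>) \<subseteq> topspace M"
      using insert.prems openin_subset by (fastforce simp: \<U>_def)
    have "continuous_map M euclideanreal (\<lambda>x. D x + D' (e x))"
      using D(2) continuous_map_compose[OF e D'(2)] by (intro continuous_map_add) (auto simp: o_def)
    moreover have "D x + D' (e x) \<le> 0 \<and> (D x + D' (e x) = 0 \<longrightarrow> (e' \<circ> e) x = x)" if x: "x \<in> topspace M" for x
      using D(3)[OF x] D'(3)[OF eM[OF x]] by auto
    moreover have "D x + D' (e x) < 0" if x: "x \<in> \<Union>(insert V \<F>)" for x
    proof -
      have xM: "x \<in> topspace M" using x sub by blast
      note * = D(3)[OF xM] D'(3)[OF eM[OF xM]]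
      show ?thesis
      \<comment> \<open>If the earlier pushes gained nothing at \<open>x\<close>, they left it in
        place and \<open>x\<close> lies in no earlier member of the cover; so
        \<open>x \<in> V\<close>, and the new push acts at \<open>e x = x\<close>. Otherwise the
        gain is already strict and the new push cannot undo it.\<close>
      proof (cases "D x = 0")
        case True
        then have "x \<in> V" using x D(4)[of x] by auto
        then show ?thesis using * True D'(4)[of x] by simp
      qed (use * in auto)
    qed
    moreover have "deforms M \<A> \<omega> (e' \<circ> e) (\<lambda>x. D x + D' (e x))"
      by (rule deforms_compose[OF D(1) D'(1)])
    ultimately have "good (\<Union>(insert V \<F>)) (e' \<circ> e) (\<lambda>x. D x + D' (e x))"
      unfolding good_def by blast
    then show ?case by blast
  qed
  then obtain e D where g: "good (\<Union>\<F>) e D" by blast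
  then have D: "deforms M \<A> \<omega> e D" "continuous_map M euclideanreal D" "\<And>x. x \<in> topspace M \<Longrightarrow> D x < 0"
    using \<F>(3) unfolding good_def by blast+
  show ?thesis
  \<comment> \<open>On the empty space no maximum of \<open>D\<close> exists and any positive
    \<epsilon> will do; otherwise -\<epsilon> is the maximum of \<open>D\<close>.\<close>
  proof (cases "topspace M = {}")
    case True
    then show ?thesis using D(1) by (intro exI[of _ e] exI[of _ D] exI[of _ 1]) auto
  next
    case False
    have "compact (D ` topspace M)"
      using image_compactin[OF \<open>compactin M (topspace M)\<close> D(2)] by simp
    then obtain y where y: "y \<in> topspace M" "\<And>x. x \<in> topspace M \<Longrightarrow> D x \<le> D y"
      using compact_attains_sup[of "D ` topspace M"] False by auto
    then show ?thesis using D by (intro exI[of _ e] exI[of _ D] exI[of _ "- D y"]) auto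
  qed
qed

section \<open>Change of representative and vanishing of the category\<close>

text \<open>Adding \<open>f\<close> to a primitive of \<theta> gives one of \<omega> on the same
  open set, so the subdivision is kept; the contributions of the globally defined \<open>f\<close>
  telescope.\<close>

lemma has_path_integral_add_exact:
  assumes f: "smooth_function \<A> f"
    and \<omega>: "\<And>c u v. c \<in> \<A> \<Longrightarrow> u \<in> chart_image c \<Longrightarrow> \<omega> c u v = \<theta> c u v + d0 f c u v"
    and I: "has_path_integral M \<A> \<theta> \<gamma> I"
  shows "has_path_integral M \<A> \<omega> \<gamma> (I + (f (\<gamma> 1) - f (\<gamma> 0)))"
proof -
  have prim: "primitive_on \<A> \<omega> U (\<lambda>x. g x + f x)" if g: "primitive_on \<A> \<theta> U g" for U g
    unfolding primitive_on_def
  proof (intro ballI)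
    fix c p assume c: "c \<in> \<A>" and p: "p \<in> U \<inter> chart_dom c"
    have im: "chart_map c p \<in> chart_image c" using p by blast
    have "((g \<circ> chart_inv c) has_derivative \<theta> c (chart_map c p)) (at (chart_map c p))"
      using g c p unfolding primitive_on_def by blast
    moreover have "((f \<circ> chart_inv c) has_derivative d0 f c (chart_map c p)) (at (chart_map c p))"
      unfolding d0_def using f c im smooth_on_has_derivative unfolding smooth_function_def by blast
    ultimately have "((\<lambda>u. (g \<circ> chart_inv c) u + (f \<circ> chart_inv c) u) has_derivative
        (\<lambda>v. \<theta> c (chart_map c p) v + d0 f c (chart_map c p) v)) (at (chart_map c p))"
      by (rule has_derivative_add)
    moreover have "(\<lambda>v. \<theta> c (chart_map c p) v + d0 f c (chart_map c p) v) = \<omega> c (chart_map c p)"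
      using \<omega>[OF c im] by (intro ext) simp
    ultimately show "(((\<lambda>x. g x + f x) \<circ> chart_inv c) has_derivative \<omega> c (chart_map c p)) (at (chart_map c p))"
      by (simp add: o_def)
  qed
  obtain m and t :: "nat \<Rightarrow> real" and U g where t: "t 0 = 0" "t m = 1" "\<forall>i<m. t i < t (Suc i)"
    and U: "\<forall>i<m. openin M (U i) \<and> \<gamma> ` {t i..t (Suc i)} \<subseteq> U i \<and> primitive_on \<A> \<theta> (U i) (g i)"
    and I: "I = (\<Sum>i<m. g i (\<gamma> (t (Suc i))) - g i (\<gamma> (t i)))"
    using I unfolding has_path_integral_def by blast
  have "(\<Sum>i<m. f (\<gamma> (t (Suc i))) - f (\<gamma> (t i))) = f (\<gamma> 1) - f (\<gamma> 0)"
    using sum_lessThan_telescope[of "\<lambda>i. f (\<gamma> (t i))" m] t(1,2) by simp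
  then have "I + (f (\<gamma> 1) - f (\<gamma> 0)) =
      (\<Sum>i<m. (g i (\<gamma> (t (Suc i))) + f (\<gamma> (t (Suc i)))) - (g i (\<gamma> (t i)) + f (\<gamma> (t i))))"
    unfolding I by (simp add: sum_subtractf sum.distrib)
  then show ?thesis
    unfolding has_path_integral_def using t U prim
    by (intro exI[of _ m] exI[of _ t] exI[of _ U] exI[of _ "\<lambda>i x. g i x + f x"]) auto
qed

lemma continuous_map_smooth_function:
  assumes f: "smooth_function \<A> f" shows "continuous_map M euclideanreal f"
proof (rule pasting_lemma[where I=\<A> and T=chart_dom and f="\<lambda>_. f"])
  fix c assume c: "c \<in> \<A>"
  show "openin M (chart_dom c)" by (rule openin_chart_dom[OF c])
  have "continuous_on (chart_image c) (f \<circ> chart_inv c)"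
    using f c smooth_on_continuous_on unfolding smooth_function_def by blast
  then have "continuous_map (top_of_set (chart_image c)) euclideanreal (f \<circ> chart_inv c)" by simp
  then have "continuous_map (subtopology M (chart_dom c)) euclideanreal ((f \<circ> chart_inv c) \<circ> chart_map c)"
    by (rule continuous_map_compose[OF homeomorphic_imp_continuous_map[OF homeomorphic_map_chart[OF c]]])
  then show "continuous_map (subtopology M (chart_dom c)) euclideanreal f"
    by (rule continuous_map_eq) (use c in auto)
qed (use chart_exists in blast)+

text \<open>For \<open>k = 0\<close> no null-homotopic sets occur, so the open set \<open>F\<close>
  has to be all of \<open>M\<close>; the point is that the whole space is \<open>N\<close>-movable
  for each \<open>N\<close>.\<close>

lemma cat_form_eq_0_of_nonvanishing:
  assumes compact: "compact_space M" and \<theta>: "closed_one_form \<A> \<theta>"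
    and nz: "\<And>c u. c \<in> \<A> \<Longrightarrow> u \<in> chart_image c \<Longrightarrow> \<exists>v. \<theta> c u v \<noteq> 0"
    and \<omega>: "\<omega> \<in> de_Rham_class \<A> \<theta>"
  shows "cat_form M \<A> \<omega> = 0"
proof -
  obtain e D \<epsilon> where D: "0 < \<epsilon>" "deforms M \<A> \<theta> e D" "\<And>x. x \<in> topspace M \<Longrightarrow> D x \<le> - \<epsilon>"
    using deforms_of_nonvanishing[OF compact \<theta> nz] by blast
  obtain f where f: "smooth_function \<A> f"
    "\<And>c u v. c \<in> \<A> \<Longrightarrow> u \<in> chart_image c \<Longrightarrow> \<omega> c u v = \<theta> c u v + d0 f c u v"
    using \<omega> unfolding de_Rham_class_def by blast
  have "compact (f ` topspace M)"
    using image_compactin[OF _ continuous_map_smooth_function[OF f(1)]] compact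
    by (simp add: compact_space_def)
  then obtain C where C: "\<forall>x\<in>topspace M. \<bar>f x\<bar> \<le> C"
    by (auto dest!: compact_imp_bounded simp: bounded_iff)
  have "movable M \<A> \<omega> N (topspace M)" for N
  proof -
    \<comment> \<open>\<open>n\<close> rounds lower the integral of \<theta> by at least
      \<open>n * \<epsilon>\<close>; the summand \<open>2 * C\<close> bounds what the exact part can
      add between the endpoints of a track.\<close>
    obtain n :: nat where n: "(N + 2 * C) / \<epsilon> < real n" using reals_Archimedean2 by blast
    then have n: "N + 2 * C < real n * \<epsilon>" using D(1) by (simp add: pos_divide_less_eq)
    obtain e' D' where D': "deforms M \<A> \<theta> e' D'" "\<And>x. x \<in> topspace M \<Longrightarrow> D' x \<le> - (real n * \<epsilon>)"
      using deforms_iterate[OF \<theta> D(2,3)] by blast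
    then obtain H where H: "continuous_map (prod_topology (top_of_set {0..1}) M) M (\<lambda>(t, x). H t x)"
      "\<And>x. x \<in> topspace M \<Longrightarrow> H (0::real) x = x \<and> has_path_integral M \<A> \<theta> (\<lambda>t. H t x) (D' x)"
      unfolding deforms_def by blast
    have "path_integral M \<A> \<omega> (\<lambda>t. H t x) \<le> - N" if x: "x \<in> topspace M" for x
    proof -
      have "continuous_map (top_of_set {0..1}) (prod_topology (top_of_set {0..1::real}) M) (\<lambda>t. (t, x))"
        using x by (intro continuous_map_pairedI continuous_map_id[unfolded id_def]) simp
      from continuous_map_compose[OF this H(1)]
      have cont: "continuous_map (top_of_set {0..1}) M (\<lambda>t. H t x)" by (simp add: o_def)
      have "path_integral M \<A> \<omega> (\<lambda>t. H t x) = D' x + (f (H 1 x) - f (H 0 x))"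
        by (rule path_integral_eq[OF cont has_path_integral_add_exact[OF f conjunct2[OF H(2)[OF x]]]])
      moreover have "H 1 x \<in> topspace M" "H 0 x \<in> topspace M"
        using cont by (auto simp: continuous_map_def)
      ultimately show ?thesis using bspec[OF C, of "H 1 x"] bspec[OF C, of "H 0 x"] D'(2)[OF x] n by linarith
    qed
    then show ?thesis unfolding movable_def using H by (intro exI[of _ H]) auto
  qed
  then show ?thesis
    unfolding cat_form_def by (intro Least_equality) (auto intro!: exI[of _ "topspace M"])
qed

section \<open>Constancy of the Lee pairing and conclusion\<close>

lemma lee_pairing_constant:
  assumes conn: "connected_space M" and lcs: "lcs_manifold M \<A> \<Omega> \<theta>"
    and X: "X \<in> lcs_vector_fields \<A> \<Omega>"
    and c: "c \<in> \<A>" "u \<in> chart_image c" and d: "d \<in> \<A>" "w \<in> chart_image d"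
  shows "\<theta> c u (X c u) = \<theta> d w (X d w)"
proof -
  define f where "f = (\<lambda>c u. \<theta> c u (X c u))"
  \<comment> \<open>Connectedness speaks about \<open>M\<close>, so the coordinate expressions are
    glued to a function on \<open>M\<close>. It is read off in an arbitrary chart at
    \<open>p\<close>; by \<open>f_eq\<close> the choice does not matter.\<close>
  define F where "F = (\<lambda>p. let c = (SOME c. c \<in> \<A> \<and> p \<in> chart_dom c) in f c (chart_map c p))"
  have th: "one_form \<A> \<theta>" and clo: "closed_one_form \<A> \<theta>" and Om: "two_form \<A> \<Omega>" and nd: "nondegenerate \<A> \<Omega>"
    using lcs unfolding lcs_manifold_def closed_one_form_def by blast+
  have Xv: "vector_field \<A> X" using X unfolding lcs_vector_fields_def by blast
  have dim: "DIM('e) > 2" using lcs unfolding lcs_manifold_def by auto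
  have f_eq: "f c (chart_map c p) = f d (chart_map d p)"
    if "c \<in> \<A>" "d \<in> \<A>" "p \<in> chart_dom c" "p \<in> chart_dom d" for c d p
  proof -
    have ov: "chart_map c p \<in> overlap c d" using that by (intro chart_map_in_overlap)
    have tr: "transition c d (chart_map c p) = chart_map d p" using that by (intro transition_chart_map)
    have "X d (chart_map d p) = frechet_derivative (transition c d) (at (chart_map c p)) (X c (chart_map c p))"
      using Xv that(1,2) ov tr unfolding vector_field_def by metis
    moreover have "\<theta> c (chart_map c p) (X c (chart_map c p)) =
       \<theta> d (chart_map d p) (frechet_derivative (transition c d) (at (chart_map c p)) (X c (chart_map c p)))"
      using th that(1,2) ov tr unfolding one_form_def by metis
    ultimately show ?thesis by (simp add: f_def)
  qed
  have F_eq: "F p = f c (chart_map c p)" if "c \<in> \<A>" "p \<in> chart_dom c" for c p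
  proof -
    have "\<exists>c. c \<in> \<A> \<and> p \<in> chart_dom c" using that by blast
    then have "(SOME c. c \<in> \<A> \<and> p \<in> chart_dom c) \<in> \<A> \<and> p \<in> chart_dom (SOME c. c \<in> \<A> \<and> p \<in> chart_dom c)"
      by (rule someI_ex)
    then show ?thesis unfolding F_def Let_def using f_eq that by blast
  qed
  have der0: "(f c has_derivative (\<lambda>_. 0)) (at u)" if c: "c \<in> \<A>" and u: "u \<in> chart_image c" for c u
  proof -
    have lin: "linear (\<theta> c x)" if "x \<in> chart_image c" for x
      using th c that unfolding one_form_def by blast
    have sth: "smooth_on (\<lambda>x. \<theta> c x v) (chart_image c)" for v
      using th c unfolding one_form_def by blast
    have sX: "smooth_on (X c) (chart_image c)" using Xv c unfolding vector_field_def by blast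
    have sOm: "smooth_on (\<lambda>x. \<Omega> c x v w) (chart_image c)" for v w
      using Om c unfolding two_form_def by blast
    have bil: "bilinear (\<Omega> c x)" and alt: "\<Omega> c x v v = 0" if "x \<in> chart_image c" for x v
      using Om c that unfolding two_form_def by blast+
    have wedge: "frechet_derivative (\<lambda>x. \<theta> c x (X c x)) (at u) v * \<Omega> c u w z
        - frechet_derivative (\<lambda>x. \<theta> c x (X c x)) (at u) w * \<Omega> c u v z
        + frechet_derivative (\<lambda>x. \<theta> c x (X c x)) (at u) z * \<Omega> c u v w = 0" for v w z
    proof (rule d_pairing_wedge_eq_0[OF open_chart_image[OF c] bil alt sOm lin sth sX])
      fix x v w z assume x: "x \<in> chart_image c"
      show "frechet_derivative (\<lambda>y. \<theta> c y w) (at x) v = frechet_derivative (\<lambda>y. \<theta> c y v) (at x) w"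
        using clo c x unfolding closed_one_form_def d1_def by (metis eq_iff_diff_eq_0)
      have "d2 \<Omega> c x v w z = wedge12 \<theta> \<Omega> c x v w z" using lcs c x unfolding lcs_manifold_def by blast
      then show "frechet_derivative (\<lambda>y. \<Omega> c y w z) (at x) v - frechet_derivative (\<lambda>y. \<Omega> c y v z) (at x) w
        + frechet_derivative (\<lambda>y. \<Omega> c y v w) (at x) z
        = \<theta> c x v * \<Omega> c x w z - \<theta> c x w * \<Omega> c x v z + \<theta> c x z * \<Omega> c x v w"
        by (simp add: d2_def wedge12_def)
      have "lie_derivative2 X \<Omega> c x v w = 0" using X c x unfolding lcs_vector_fields_def by blast
      then show "frechet_derivative (\<lambda>y. \<Omega> c y v w) (at x) (X c x)
        + \<Omega> c x (frechet_derivative (X c) (at x) v) w + \<Omega> c x v (frechet_derivative (X c) (at x) w) = 0"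
        by (simp add: lie_derivative2_def)
    qed (use u in simp_all)
    have h: "(f c has_derivative frechet_derivative (\<lambda>x. \<theta> c x (X c x)) (at u)) (at u)"
      unfolding f_def
      by (rule smooth_on_has_derivative[OF smooth_on_linear_family[OF open_chart_image[OF c] lin sth sX] u])
    have "frechet_derivative (\<lambda>x. \<theta> c x (X c x)) (at u) v = 0" for v
    proof (rule eq_0_of_wedge_nondegenerate[OF dim bil[OF u] alt[OF u] _ has_derivative_linear[OF h] wedge])
      show "v = 0" if "\<And>w. \<Omega> c u v w = 0" for v
        using nd c u that unfolding nondegenerate_def by blast
    qed
    then have "frechet_derivative (\<lambda>x. \<theta> c x (X c x)) (at u) = (\<lambda>_. 0)" by (rule ext)
    then show ?thesis using h by simp
  qed
  have loc: "\<exists>V. openin M V \<and> p \<in> V \<and> (\<forall>q\<in>V. F q = F p)" if "p \<in> topspace M" for p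
  proof -
    obtain c where c: "c \<in> \<A>" "p \<in> chart_dom c" using chart_exists \<open>p \<in> topspace M\<close> by blast
    \<comment> \<open>The repeated intersection arises because the open set in the lemma on local
      constancy is the chart domain itself.\<close>
    have "((F \<circ> chart_inv c) has_derivative (\<lambda>_. 0)) (at (chart_map c q))" if q: "q \<in> chart_dom c \<inter> chart_dom c" for q
    proof (rule has_derivative_transform_within_open[OF der0[OF c(1)] open_chart_image[OF c(1)]])
      show "f c x = (F \<circ> chart_inv c) x" if "x \<in> chart_image c" for x
        using F_eq[OF c(1) chart_inv_in_dom[OF that]] that by simp
    qed (use q in auto)
    from locally_constant_of_chart_derivative[OF c(1) openin_chart_dom[OF c(1)] _ this] c(2)
    show ?thesis by blast
  qed
  have "chart_inv c u \<in> topspace M" "chart_inv d w \<in> topspace M"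
    using c d chart_dom_subset by blast+
  then have "F (chart_inv c u) = F (chart_inv d w)"
    using connected_space_locally_constant[OF conn, of F] loc by blast
  then show ?thesis
    using F_eq[OF c(1) chart_inv_in_dom[OF c(2)]] F_eq[OF d(1) chart_inv_in_dom[OF d(2)]] c(2) d(2)
    by (simp add: f_def)
qed

end

lemma closed_one_form_in_de_Rham_class:
  assumes "closed_one_form \<A> \<theta>" shows "\<theta> \<in> de_Rham_class \<A> \<theta>"
  using assms unfolding de_Rham_class_def smooth_function_def
  by (auto intro!: exI[of _ "\<lambda>_. 0"] simp: d0_def o_def smooth_on_const)

theorem proposition3p3:
  fixes M :: "'a topology"
    and \<A> :: "('a, 'e::euclidean_space) chart set"
    and \<Omega> :: "('a, 'e) form2"
    and \<theta> :: "('a, 'e) form1"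
  assumes "closed_manifold M \<A>"
    and "connected_space M"
    and "lcs_manifold M \<A> \<Omega> \<theta>"
    and "cat_class M \<A> (de_Rham_class \<A> \<theta>) > 0"
  shows "lcs_second_kind \<A> \<Omega> \<theta>"
proof (rule ccontr)
  interpret manifold M \<A>
    using assms(1) by unfold_locales (simp add: closed_manifold_def)
  have \<theta>: "closed_one_form \<A> \<theta>" using assms(3) unfolding lcs_manifold_def by blast
  assume "\<not> lcs_second_kind \<A> \<Omega> \<theta>"
  then obtain X where X: "X \<in> lcs_vector_fields \<A> \<Omega>" "lee_hom \<A> \<theta> X \<noteq> 0"
    unfolding lcs_second_kind_def by blast
  have "\<exists>v. \<theta> c u v \<noteq> 0" if c: "c \<in> \<A>" "u \<in> chart_image c" for c u
  proof -
    \<comment> \<open>Constancy shows that the value at this point satisfies the description, and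
      the point itself makes it the only one.\<close>
    have "lee_hom \<A> \<theta> X = \<theta> c u (X c u)"
      unfolding lee_hom_def
    proof (rule the_equality)
      show "\<forall>d\<in>\<A>. \<forall>w\<in>chart_image d. \<theta> d w (X d w) = \<theta> c u (X c u)"
        using lee_pairing_constant[OF assms(2,3) X(1) _ _ c] by blast
    qed (metis c)
    then show ?thesis using X(2) by metis
  qed
  \<comment> \<open>The class contains \<theta>, so the chosen form really is a
    representative.\<close>
  moreover have "(SOME \<omega>. \<omega> \<in> de_Rham_class \<A> \<theta>) \<in> de_Rham_class \<A> \<theta>"
    using closed_one_form_in_de_Rham_class[OF \<theta>] by (rule someI[of "\<lambda>\<omega>. \<omega> \<in> de_Rham_class \<A> \<theta>"])
  moreover have "compact_space M" using assms(1) by (simp add: closed_manifold_def)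
  ultimately have "cat_class M \<A> (de_Rham_class \<A> \<theta>) = 0"
    unfolding cat_class_def using cat_form_eq_0_of_nonvanishing[OF _ \<theta>] by blast
  then show False using assms(4) by simp
qed

end
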